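(* Let $A \in \mathbb{R}^{m\times n}$ and $b \in \mathbb{R}^m$ satisfy the sample model and data structure, and let the parameters $\epsilon>0$, $\delta\in(0,1)$ and the positive integer $k$ be as in the QiSVD algorithm. Assume $m \ge n+1$ and $d \le l \le q \le k \le n$, where $l$ is the number of columns of the output $\hat V$ of the QiSVD algorithm. Suppose $C=[A,\,b]$ has singular values $\sigma_1,\sigma_2,\dots,\sigma_{n+1}$ and $A$ has singular values $\sigma^A_1,\sigma^A_2,\dots,\sigma^A_n$ (both in non-increasing order). Assume that $\sigma_i^2-\sigma_{i+1}^2=\eta_i$ for $i\in\{1,\dots,q\}$, put $\eta=\min\{\eta_1,\dots,\eta_q\}$, and assume $\sigma^A_q>\sigma_{q+1}$. Let $$x_{\rm QiTTLS}=(\hat{\mathbf V}_{11}^T)^\dagger \hat{\mathbf v}_{21}^T,\qquad x_{\rm TTLS}=(\mathbf V_{11}^T)^\dagger \mathbf v_{21}^T$$ be the outputs of the QiTTLS and TTLS algorithms, respectively. Let $\mathbf V_{11}\in\mathbb{R}^{n\times d}$ have singular values $\tau_1\ge\tau_2\ge\cdots\ge\tau_d$, and set $$\epsilon_v=\sqrt{\frac{40k\epsilon}{\eta}}\,\|C\|_F+\xi .$$ If $\eta\ge 20\epsilon\|C\|_F^2$, $\|x_{\rm TTLS}\|_2\neq 0$, $\tau_d>\epsilon_v$ and $\|b\|_2>\sigma_{d+1}$, then with probability at least $1-\delta$, $$\frac{\|x_{\rm TTLS}-x_{\rm QiTTLS}\|_2}{\|x_{\rm TTLS}\|_2}\le \frac{\sqrt2\,\epsilon_v+\tau_d+1}{\tau_d-\epsilon_v}\cdot\frac{2\sigma_1}{\|b\|_2-\sigma_{d+1}}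 .$$
   Context: Notation. $\|\cdot\|_2$ is the Euclidean norm of a vector or spectral norm of a matrix, $\|\cdot\|_F$ the Frobenius norm, $M^\dagger$ the Moore-Penrose inverse, $M_{i,:}$ and $M_{:,j}$ the $i$-th row and $j$-th column of $M$, and $[p]=\{1,\dots,p\}$. Throughout $m\ge n$. Sample model and data structure. $A$ and $b$ are stored so that, for $C=[A,\,b]\in\mathbb{R}^{m\times(n+1)}$, one can sample a row index $i\in[m]$ with probability $P_i=\|C_{i,:}\|_2^2/\|C\|_F^2$, and for each row $i$ sample a column index $j$ with probability $\mathcal D_{C_{i,:}}(j)=|C_{i,j}|^2/\|C_{i,:}\|_2^2$; entries, row/column norms and the Frobenius norm can be queried. QiSVD algorithm. Input: $A$, $b$, $\epsilon>0$, a positive integer $k$, $\delta\in(0,1)$. (1) Put $C=[A,\,b]$, $\xi=\frac{\epsilon}{2\epsilon+4}$, $\alpha=\frac{\xi}{100k^4}$, $\theta=\alpha\xi$, $p=\lceil \frac{1}{\theta^2\delta}\rceil$. (2) Independently sample $p$ row indices $i_1,\dots,i_p$ of $C$ from the distribution $\{P_i\}_{i=1}^m$. (3) Let $S\in\mathbb{R}^{p\times(n+1)}$ have rows $S_{t,:}=C_{i_t,:}/\sqrt{pP_{i_t}}$, $t\in[p]$. (4) Independently sample $p$ column indices $j_1,\dots,j_p$ of $S$ from the distribution $P'_j=\frac1p\sum_{t=1}^p\mathcal D_{C_{i_t,:}}(j)$, $j\in[n+1]$. (5) Let $W\in\mathbb{R}^{p\times p}$ have columns $W_{:,t}=S_{:,j_t}/\sqrt{pP'_{j_t}}$,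 $t\in[p]$. (6) Compute the SVD $W=\sum_{t=1}^p\bar\sigma_t\bar u_t\bar v_t^T$ with $\bar\sigma_1\ge\cdots\ge\bar\sigma_p$. (7) Let $l=\min\{k,\max\{t\in[p]:\bar\sigma_t^2\ge\alpha\|W\|_F^2\}\}$. (8) Output $\hat V=S^T\bar U\bar\Sigma^{-1}\in\mathbb{R}^{(n+1)\times l}$, where $\bar U=(\bar u_1,\dots,\bar u_l)$ and $\bar\Sigma=\mathrm{diag}(\bar\sigma_1,\dots,\bar\sigma_l)$. Probability is over the random sampling. QiTTLS algorithm. With $\hat V$ the output of QiSVD and $d\le l$, put $\hat{\mathbf V}_{11}=\hat V_{1:n,1:d}$ (first $n$ rows, first $d$ columns), $\hat{\mathbf v}_{21}=\hat V_{n+1,1:d}$ (last row, first $d$ entries); output $x_{\rm QiTTLS}=(\hat{\mathbf V}_{11}^T)^\dagger\hat{\mathbf v}_{21}^T$. TTLS algorithm. With $C=U\Sigma V^T$ the singular value decomposition of $C$ (singular values in non-increasing order, $V\in\mathbb{R}^{(n+1)\times(n+1)}$ orthogonal) and $d\le q$, put $\mathbf V_{11}=V_{1:n,1:d}$, $\mathbf v_{21}=V_{n+1,1:d}$; output $x_{\rm TTLS}=(\mathbf V_{11}^T)^\dagger\mathbf v_{21}^T$. *)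

theory Defs
  imports "HOL-Probability.Product_PMF" "Jordan_Normal_Form.Matrix"
begin

unbundle no vec_syntax

text \<open>
  Matrices and vectors are those of \<^theory>\<open>Jordan_Normal_Form.Matrix\<close>, whose entries are indexed
  from 0, so row and column \<open>i\<close> here is row and column \<open>i + 1\<close> in the usual notation. Sequences of
  singular values, in contrast, are indexed from 1: \<open>s 1 \<ge> s 2 \<ge> \<dots>\<close>.
\<close>

section \<open>Matrix preliminaries\<close>

definition vec_norm2 :: "real vec \<Rightarrow> real" where
  "vec_norm2 v = L2_set (\<lambda>i. v $ i) {..<dim_vec v}"

definition frob_norm :: "real mat \<Rightarrow> real" where
  "frob_norm M = L2_set (\<lambda>ij. M $$ ij) ({..<dim_row M} \<times> {..<dim_col M})"

definition augment :: "real mat \<Rightarrow> real vec \<Rightarrow> real mat" where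
  "augment A b = mat_of_cols (dim_row A) (cols A @ [b])"

text \<open>
  Orthogonality of \<open>U\<close> and \<open>V\<close> is spelled out because the library predicate \<^const>\<open>orthogonal_mat\<close>
  does not require the columns to be normalised.
\<close>

fun is_svd :: "real mat \<Rightarrow> real mat \<times> (nat \<Rightarrow> real) \<times> real mat \<Rightarrow> bool" where
  "is_svd M (U, s, V) \<longleftrightarrow>
     U \<in> carrier_mat (dim_row M) (dim_row M) \<and> transpose_mat U * U = 1\<^sub>m (dim_row M) \<and>
     V \<in> carrier_mat (dim_col M) (dim_col M) \<and> transpose_mat V * V = 1\<^sub>m (dim_col M) \<and>
     (\<forall>i\<in>{1..min (dim_row M) (dim_col M)}. 0 \<le> s i) \<and>
     antimono_on {1..min (dim_row M) (dim_col M)} s \<and>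
     M = U * Matrix.mat (dim_row M) (dim_col M) (\<lambda>(i, j). if i = j then s (i + 1) else 0)
           * transpose_mat V"

definition singular_values :: "real mat \<Rightarrow> (nat \<Rightarrow> real) \<Rightarrow> bool" where
  "singular_values M s \<longleftrightarrow> (\<exists>U V. is_svd M (U, s, V))"

definition is_pinv :: "real mat \<Rightarrow> real mat \<Rightarrow> bool" where
  "is_pinv M X \<longleftrightarrow> X \<in> carrier_mat (dim_col M) (dim_row M) \<and>
     M * X * M = M \<and> X * M * X = X \<and>
     transpose_mat (M * X) = M * X \<and> transpose_mat (X * M) = X * M"

definition pinv :: "real mat \<Rightarrow> real mat" where
  "pinv M = (THE X. is_pinv M X)"

lemma is_pinv_mult_right_unique:
  assumes "is_pinv M X" "is_pinv M Y"
  shows "M * X = M * Y"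
proof -
  have M: "M \<in> carrier_mat (dim_row M) (dim_col M)" by simp
  note X = assms(1)[unfolded is_pinv_def] and Y = assms(2)[unfolded is_pinv_def]
  have MX: "M * X \<in> carrier_mat (dim_row M) (dim_row M)" using M X by auto
  have MY: "M * Y \<in> carrier_mat (dim_row M) (dim_row M)" using M Y by auto
  have "M * X = M * Y * M * X" using Y by simp
  also have "\<dots> = (M * Y) * (M * X)" using assoc_mult_mat[OF MY M] X by blast
  finally have "transpose_mat (M * X) = transpose_mat (M * X) * transpose_mat (M * Y)"
    using transpose_mult[OF MY MX] by simp
  then have "M * X = (M * X) * (M * Y)" using X Y by simp
  also have "\<dots> = M * X * M * Y" using assoc_mult_mat[OF MX M] Y by metis
  also have "\<dots> = M * Y" using X by simp
  finally show ?thesis .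
qed

lemma is_pinv_transpose:
  assumes "is_pinv M X"
  shows "is_pinv (transpose_mat M) (transpose_mat X)"
proof -
  have M: "M \<in> carrier_mat (dim_row M) (dim_col M)" by simp
  note X = assms[unfolded is_pinv_def]
  have Xc: "X \<in> carrier_mat (dim_col M) (dim_row M)" using X by simp
  have MX: "M * X \<in> carrier_mat (dim_row M) (dim_row M)" using M Xc by auto
  have XM: "X * M \<in> carrier_mat (dim_col M) (dim_col M)" using M Xc by auto
  have tXM: "transpose_mat (X * M) = transpose_mat M * transpose_mat X"
    using transpose_mult[OF Xc M] .
  have tMX: "transpose_mat (M * X) = transpose_mat X * transpose_mat M"
    using transpose_mult[OF M Xc] .
  have 1: "transpose_mat M * transpose_mat X * transpose_mat M = transpose_mat M"
  proof -
    have "transpose_mat M * transpose_mat X * transpose_mat M = transpose_mat (M * (X * M))"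
      using transpose_mult[OF M XM] tXM by simp
    then show ?thesis using assoc_mult_mat[OF M Xc M] X by simp
  qed
  have 2: "transpose_mat X * transpose_mat M * transpose_mat X = transpose_mat X"
  proof -
    have "transpose_mat X * transpose_mat M * transpose_mat X = transpose_mat (X * (M * X))"
      using transpose_mult[OF Xc MX] tMX by simp
    then show ?thesis using assoc_mult_mat[OF Xc M Xc] X by simp
  qed
  show ?thesis unfolding is_pinv_def
    using 1 2 X tXM tMX Xc by simp
qed

lemma pinv_eqI:
  assumes "is_pinv M X"
  shows "pinv M = X"
  unfolding pinv_def
proof (rule the_equality)
  show "is_pinv M X" by (rule assms)
next
  fix Y assume Y: "is_pinv M Y"
  have M: "M \<in> carrier_mat (dim_row M) (dim_col M)" by simp
  have Xc: "X \<in> carrier_mat (dim_col M) (dim_row M)"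
    and Yc: "Y \<in> carrier_mat (dim_col M) (dim_row M)"
    using assms Y by (auto simp: is_pinv_def)
  have right: "M * X = M * Y" by (rule is_pinv_mult_right_unique[OF assms Y])
  have "transpose_mat M * transpose_mat X = transpose_mat M * transpose_mat Y"
    by (rule is_pinv_mult_right_unique[OF is_pinv_transpose[OF assms] is_pinv_transpose[OF Y]])
  then have left: "X * M = Y * M"
    using transpose_mult[OF Xc M] transpose_mult[OF Yc M] by (metis transpose_transpose)
  have "Y = Y * M * Y" using Y by (simp add: is_pinv_def)
  also have "\<dots> = X * M * Y" by (simp add: left)
  also have "\<dots> = X * (M * Y)" by (rule assoc_mult_mat[OF Xc M Yc])
  also have "\<dots> = X * M * X" by (simp add: right assoc_mult_mat[OF Xc M Xc])
  also have "\<dots> = X" using assms by (simp add: is_pinv_def)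
  finally show "Y = X" .
qed


section \<open>Length-squared sampling\<close>

definition row_prob :: "real mat \<Rightarrow> nat \<Rightarrow> real" where
  "row_prob C i = (vec_norm2 (row C i))\<^sup>2 / (frob_norm C)\<^sup>2"

definition entry_prob :: "real mat \<Rightarrow> nat \<Rightarrow> nat \<Rightarrow> real" where
  "entry_prob C i j = \<bar>C $$ (i, j)\<bar>\<^sup>2 / (vec_norm2 (row C i))\<^sup>2"

text \<open>
  In the following, \<open>rs t\<close> is the \<open>t\<close>-th sampled row index and \<open>cs t\<close> the \<open>t\<close>-th sampled column
  index, for \<open>t < p\<close>.
\<close>

definition col_prob :: "real mat \<Rightarrow> nat \<Rightarrow> (nat \<Rightarrow> nat) \<Rightarrow> nat \<Rightarrow> real" where
  "col_prob C p rs j = (1 / real p) * (\<Sum>t<p. entry_prob C (rs t) j)"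

text \<open>
  \<^const>\<open>embed_pmf\<close> is only meaningful for weights that sum to 1; see \<open>pmf_row_pmf\<close> and
  \<open>pmf_col_pmf\<close> below. For a nonzero matrix \<open>C\<close>, rows of norm 0 are never drawn.
\<close>

definition row_pmf :: "real mat \<Rightarrow> nat pmf" where
  "row_pmf C = embed_pmf (\<lambda>i. if i < dim_row C then row_prob C i else 0)"

definition col_pmf :: "real mat \<Rightarrow> nat \<Rightarrow> (nat \<Rightarrow> nat) \<Rightarrow> nat pmf" where
  "col_pmf C p rs = embed_pmf (\<lambda>j. if j < dim_col C then col_prob C p rs j else 0)"

lemma pmf_embed_finite:
  fixes f :: "nat \<Rightarrow> real"
  assumes "\<And>i. i < N \<Longrightarrow> 0 \<le> f i" and "(\<Sum>i<N. f i) = 1"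
  shows "pmf (embed_pmf (\<lambda>i. if i < N then f i else 0)) i = (if i < N then f i else 0)"
proof (rule pmf_embed_pmf)
  show "0 \<le> (if x < N then f x else 0)" for x using assms(1) by simp
  have "(\<integral>\<^sup>+x. ennreal (if x < N then f x else 0) \<partial>count_space UNIV)
      = (\<Sum>x<N. ennreal (if x < N then f x else 0))"
    by (rule nn_integral_count_space') auto
  also have "\<dots> = ennreal (\<Sum>x<N. f x)"
    using assms(1) by (subst sum_ennreal[symmetric]) auto
  finally show "(\<integral>\<^sup>+x. ennreal (if x < N then f x else 0) \<partial>count_space UNIV) = 1"
    using assms(2) by simp
qed

lemma frob_norm_sq: "(frob_norm M)\<^sup>2 = (\<Sum>i<dim_row M. (vec_norm2 (row M i))\<^sup>2)"
proof -
  have "(frob_norm M)\<^sup>2 = (\<Sum>ij\<in>{..<dim_row M} \<times> {..<dim_col M}. (M $$ ij)\<^sup>2)"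
    by (simp add: frob_norm_def L2_set_def sum_nonneg)
  also have "\<dots> = (\<Sum>i<dim_row M. \<Sum>j<dim_col M. (M $$ (i, j))\<^sup>2)"
    by (simp add: sum.cartesian_product split_def)
  also have "\<dots> = (\<Sum>i<dim_row M. (vec_norm2 (row M i))\<^sup>2)"
    by (intro sum.cong) (auto simp: vec_norm2_def L2_set_def sum_nonneg)
  finally show ?thesis .
qed

lemma pmf_row_pmf:
  assumes "frob_norm C \<noteq> 0"
  shows "pmf (row_pmf C) i = (if i < dim_row C then row_prob C i else 0)"
  unfolding row_pmf_def
proof (rule pmf_embed_finite)
  show "(\<Sum>i<dim_row C. row_prob C i) = 1"
    unfolding row_prob_def sum_divide_distrib[symmetric] frob_norm_sq[symmetric]
    using assms by simp
qed (simp add: row_prob_def)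

lemma pmf_col_pmf:
  assumes "0 < p" and "\<And>t. t < p \<Longrightarrow> rs t < dim_row C \<and> vec_norm2 (row C (rs t)) \<noteq> 0"
  shows "pmf (col_pmf C p rs) j = (if j < dim_col C then col_prob C p rs j else 0)"
  unfolding col_pmf_def
proof (rule pmf_embed_finite)
  have row: "(\<Sum>j<dim_col C. entry_prob C (rs t) j) = 1" if "t < p" for t
  proof -
    have "(vec_norm2 (row C (rs t)))\<^sup>2 = (\<Sum>j<dim_col C. (C $$ (rs t, j))\<^sup>2)"
      using assms(2)[OF that] by (auto simp: vec_norm2_def L2_set_def sum_nonneg)
    then show ?thesis
      using assms(2)[OF that] unfolding entry_prob_def sum_divide_distrib[symmetric]
      by (metis (no_types, lifting) div_self power2_abs power_not_zero sum.cong)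
  qed
  have "(\<Sum>j<dim_col C. col_prob C p rs j)
      = (1 / real p) * (\<Sum>t<p. \<Sum>j<dim_col C. entry_prob C (rs t) j)"
    unfolding col_prob_def sum_distrib_left[symmetric] by (subst sum.swap) (rule refl)
  also have "\<dots> = 1" using row assms(1) by simp
  finally show "(\<Sum>j<dim_col C. col_prob C p rs j) = 1" .
qed (simp add: col_prob_def entry_prob_def sum_nonneg)


section \<open>QiSVD\<close>

definition qisvd_xi :: "real \<Rightarrow> real" where
  "qisvd_xi \<epsilon> = \<epsilon> / (2 * \<epsilon> + 4)"

definition qisvd_alpha :: "real \<Rightarrow> nat \<Rightarrow> real" where
  "qisvd_alpha \<epsilon> k = qisvd_xi \<epsilon> / (100 * real k ^ 4)"

definition qisvd_theta :: "real \<Rightarrow> nat \<Rightarrow> real" where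
  "qisvd_theta \<epsilon> k = qisvd_alpha \<epsilon> k * qisvd_xi \<epsilon>"

definition qisvd_p :: "real \<Rightarrow> nat \<Rightarrow> real \<Rightarrow> nat" where
  "qisvd_p \<epsilon> k \<delta> = nat \<lceil>1 / ((qisvd_theta \<epsilon> k)\<^sup>2 * \<delta>)\<rceil>"

definition sketch_S :: "real mat \<Rightarrow> nat \<Rightarrow> (nat \<Rightarrow> nat) \<Rightarrow> real mat" where
  "sketch_S C p rs =
     Matrix.mat p (dim_col C) (\<lambda>(t, j). C $$ (rs t, j) / sqrt (real p * row_prob C (rs t)))"

definition sketch_W :: "real mat \<Rightarrow> nat \<Rightarrow> (nat \<Rightarrow> nat) \<Rightarrow> (nat \<Rightarrow> nat) \<Rightarrow> real mat" where
  "sketch_W C p rs cs =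
     Matrix.mat p p (\<lambda>(r, t). sketch_S C p rs $$ (r, cs t) / sqrt (real p * col_prob C p rs (cs t)))"

text \<open>If no singular value passes the threshold, the truncation index is 0.\<close>

definition trunc_index :: "nat \<Rightarrow> nat \<Rightarrow> real \<Rightarrow> real mat \<Rightarrow> (nat \<Rightarrow> real) \<Rightarrow> nat" where
  "trunc_index p k \<alpha> W s =
     min k (Max (insert 0 {t \<in> {1..p}. (s t)\<^sup>2 \<ge> \<alpha> * (frob_norm W)\<^sup>2}))"

text \<open>
  A singular value decomposition is not unique, so the one of \<open>W\<close> is taken from a routine \<open>svd\<close>,
  which is a parameter.
\<close>

definition qisvd_output ::
  "(real mat \<Rightarrow> real mat \<times> (nat \<Rightarrow> real) \<times> real mat) \<Rightarrow> real mat \<Rightarrow> nat \<Rightarrow> nat \<Rightarrow> real \<Rightarrow>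
   (nat \<Rightarrow> nat) \<Rightarrow> (nat \<Rightarrow> nat) \<Rightarrow> real mat" where
  "qisvd_output svd C p k \<alpha> rs cs =
     (let W = sketch_W C p rs cs;
          (U, s, V) = svd W;
          l = trunc_index p k \<alpha> W s;
          U\<^sub>l = Matrix.mat p l (\<lambda>(r, t). U $$ (r, t));
          \<Sigma>\<^sub>l_inv = mat_diag l (\<lambda>t. inverse (s (t + 1)))
      in transpose_mat (sketch_S C p rs) * U\<^sub>l * \<Sigma>\<^sub>l_inv)"

definition qisvd ::
  "(real mat \<Rightarrow> real mat \<times> (nat \<Rightarrow> real) \<times> real mat) \<Rightarrow> real mat \<Rightarrow> real vec \<Rightarrow>
   real \<Rightarrow> nat \<Rightarrow> real \<Rightarrow> real mat pmf" where
  "qisvd svd A b \<epsilon> k \<delta> =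
     (let C = augment A b; p = qisvd_p \<epsilon> k \<delta> in
      do {
        rs \<leftarrow> Pi_pmf {..<p} 0 (\<lambda>_. row_pmf C);
        cs \<leftarrow> Pi_pmf {..<p} 0 (\<lambda>_. col_pmf C p rs);
        return_pmf (qisvd_output svd C p k (qisvd_alpha \<epsilon> k) rs cs)
      })"


section \<open>Truncated total least squares\<close>

definition block11 :: "nat \<Rightarrow> nat \<Rightarrow> real mat \<Rightarrow> real mat" where
  "block11 n d V = Matrix.mat n d (\<lambda>(i, j). V $$ (i, j))"

definition block21 :: "nat \<Rightarrow> nat \<Rightarrow> real mat \<Rightarrow> real vec" where
  "block21 n d V = vec d (\<lambda>j. V $$ (n, j))"

text \<open>
  The same formula gives the output of TTLS (with \<open>V\<close> the exact right singular vectors of \<open>[A, b]\<close>)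
  and of QiTTLS (with \<open>V\<close> the output of QiSVD).
\<close>

definition ttls_solution :: "nat \<Rightarrow> nat \<Rightarrow> real mat \<Rightarrow> real vec" where
  "ttls_solution n d V = pinv (transpose_mat (block11 n d V)) *\<^sub>v block21 n d V"

end

theory Submission
  imports Defs "Jordan_Normal_Form.Determinant"
begin

text \<open>
  Let \<open>F = \<parallel>C\<parallel>\<^sub>F\<close>. Each of the two length-squared sampling stages has expected squared Frobenius error
  at most \<open>F\<^sup>4 / p\<close>, so by Markov's inequality both Gram matrix errors \<open>C\<^sup>T C - S\<^sup>T S\<close> and
  \<open>S S\<^sup>T - W W\<^sup>T\<close> are at most \<open>\<kappa> = \<surd>2 \<theta> F\<^sup>2\<close> with probability at least \<open>1 - \<delta>\<close>.

  Since \<open>\<epsilon>\<^sub>v < \<tau>\<^sub>d \<le> 1\<close>, the gap \<open>\<sigma>\<^sub>d\<^sup>2 - \<sigma>\<^sub>d\<^sub>+\<^sub>1\<^sup>2\<close> exceeds \<open>40 k \<epsilon> F\<^sup>2\<close>, which dwarfs \<open>\<kappa>\<close>. Hence the first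
  \<open>d\<close> columns of the QiSVD output are almost orthonormal and almost lie in the span of the first \<open>d\<close>
  right singular vectors of \<open>C\<close>, with total defect at most \<open>\<surd>\<epsilon> \<le> \<epsilon>\<^sub>v\<close>. Their upper block therefore
  has smallest singular value at least \<open>\<tau>\<^sub>d - \<epsilon>\<^sub>v\<close>, and \<open>\<parallel>x\<^sub>Q\<^sub>i\<^sub>T\<^sub>T\<^sub>L\<^sub>S\<parallel> \<le> 2 / (\<tau>\<^sub>d - \<epsilon>\<^sub>v)\<close>. On the other hand
  \<open>\<parallel>x\<^sub>T\<^sub>T\<^sub>L\<^sub>S\<parallel> \<ge> \<parallel>v\<^sub>2\<^sub>1\<parallel> \<ge> (\<parallel>b\<parallel> - \<sigma>\<^sub>d\<^sub>+\<^sub>1) / \<sigma>\<^sub>1\<close>. The claimed bound is so large that the triangle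
  inequality \<open>\<parallel>x\<^sub>T\<^sub>T\<^sub>L\<^sub>S - x\<^sub>Q\<^sub>i\<^sub>T\<^sub>T\<^sub>L\<^sub>S\<parallel> \<le> \<parallel>x\<^sub>T\<^sub>T\<^sub>L\<^sub>S\<parallel> + \<parallel>x\<^sub>Q\<^sub>i\<^sub>T\<^sub>T\<^sub>L\<^sub>S\<parallel>\<close> suffices; no perturbation theory of the
  pseudoinverse is needed.
\<close>

section \<open>Sampling\<close>

text \<open>Additivity of variance for independent centred draws: the square expands into products,
  and those of two distinct coordinates factor into a product of means, which is 0.\<close>

lemma expectation_sum_sq_Pi_pmf:
  fixes h :: "'a \<Rightarrow> real"
  assumes fin: "finite I" and q: "finite (set_pmf q)" and mean: "measure_pmf.expectation q h = 0"
  shows "measure_pmf.expectation (Pi_pmf I dflt (\<lambda>_. q)) (\<lambda>x. (\<Sum>t\<in>I. h (x t))\<^sup>2)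
    = real (card I) * measure_pmf.expectation q (\<lambda>y. (h y)\<^sup>2)"
proof -
  let ?P = "Pi_pmf I dflt (\<lambda>_. q)"
  have finP: "finite (set_pmf ?P)"
    using fin q by (simp add: set_Pi_pmf finite_PiE_dflt)
  have int: "integrable ?P f" for f :: "('b \<Rightarrow> 'a) \<Rightarrow> real"
    by (rule integrable_measure_pmf_finite[OF finP])
  have comp: "measure_pmf.expectation ?P (\<lambda>x. g (x t)) = measure_pmf.expectation q g"
    if "t \<in> I" for t and g :: "'a \<Rightarrow> real"
  proof -
    have "map_pmf (\<lambda>f. f t) ?P = q"
      using Pi_pmf_component[OF fin, of t dflt "\<lambda>_. q"] that by simp
    then have "measure_pmf.expectation q g = measure_pmf.expectation (map_pmf (\<lambda>f. f t) ?P) g"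
      by simp
    then show ?thesis by simp
  qed
  have off: "measure_pmf.expectation ?P (\<lambda>x. h (x s) * h (x t)) = 0"
    if st: "s \<in> I" "t \<in> I" "s \<noteq> t" for s t
  proof -
    have "prob_space.indep_vars ?P (\<lambda>_. count_space UNIV) (\<lambda>x f. f x) {s, t}"
      by (rule prob_space.indep_vars_subset[OF measure_pmf.prob_space_axioms indep_vars_Pi_pmf[OF fin]])
        (use st in auto)
    then have iv: "prob_space.indep_vars ?P (\<lambda>_. borel) (\<lambda>i x. h (x i)) {s, t}"
      by (rule prob_space.indep_vars_compose2[OF measure_pmf.prob_space_axioms]) auto
    have "measure_pmf.expectation ?P (\<lambda>x. \<Prod>i\<in>{s, t}. h (x i))
        = (\<Prod>i\<in>{s, t}. measure_pmf.expectation ?P (\<lambda>x. h (x i)))"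
      by (rule prob_space.indep_vars_lebesgue_integral[OF measure_pmf.prob_space_axioms _ iv])
        (auto intro: int)
    then show ?thesis
      using st comp[of s h] mean by simp
  qed
  have "measure_pmf.expectation ?P (\<lambda>x. (\<Sum>t\<in>I. h (x t))\<^sup>2)
      = (\<Sum>s\<in>I. \<Sum>t\<in>I. measure_pmf.expectation ?P (\<lambda>x. h (x s) * h (x t)))"
    unfolding power2_eq_square sum_product
    by (subst Bochner_Integration.integral_sum, rule int)+ simp
  also have "\<dots> = (\<Sum>s\<in>I. \<Sum>t\<in>I. if s = t then measure_pmf.expectation q (\<lambda>y. (h y)\<^sup>2) else 0)"
    by (intro sum.cong refl) (auto simp: off comp[of _ "\<lambda>y. h y * h y"] power2_eq_square)
  also have "\<dots> = real (card I) * measure_pmf.expectation q (\<lambda>y. (h y)\<^sup>2)"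
    using fin by simp
  finally show ?thesis .
qed

lemma expectation_finite_nat:
  fixes g :: "nat \<Rightarrow> real"
  assumes "\<And>i. pmf q i = (if i < N then w i else 0)"
  shows "measure_pmf.expectation q g = (\<Sum>i<N. w i * g i)"
    and "set_pmf q = {i. i < N \<and> w i \<noteq> 0}"
proof -
  show s: "set_pmf q = {i. i < N \<and> w i \<noteq> 0}"
    using assms by (auto simp: set_pmf_eq)
  have "measure_pmf.expectation q g = (\<Sum>i<N. g i * pmf q i)"
    by (rule integral_measure_pmf_real) (auto simp: s)
  then show "measure_pmf.expectation q g = (\<Sum>i<N. w i * g i)"
    using assms by (simp add: mult.commute)
qed

text \<open>Stated for an abstract family \<open>f\<close> because it serves both stages: first
  \<open>i\<close> runs over the rows of \<open>C\<close>, then over the columns of the sketch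
  \<open>S\<close>. Each entry of the estimator averages \<open>p\<close> unbiased draws, so its
  variance is at most the second moment of one draw divided by \<open>p\<close>. Summed over all
  entries, the second moments give \<open>G\<^sup>2\<close> because the sampling weights are
  proportional to the squared lengths.\<close>

lemma length_squared_sampling:
  fixes f :: "nat \<Rightarrow> nat \<Rightarrow> real"
  assumes q: "\<And>i. pmf q i = (if i < N then (\<Sum>a<A. (f i a)\<^sup>2) / G else 0)"
    and G: "G = (\<Sum>i<N. \<Sum>a<A. (f i a)\<^sup>2)" and p: "0 < p"
  shows "measure_pmf.expectation (Pi_pmf {..<p} 0 (\<lambda>_. q))
      (\<lambda>x. \<Sum>a<A. \<Sum>b<A. ((\<Sum>i<N. f i a * f i b)
        - (\<Sum>t<p. f (x t) a * f (x t) b / (real p * pmf q (x t))))\<^sup>2) \<le> G\<^sup>2 / real p"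
proof -
  define r where "r i = (\<Sum>a<A. (f i a)\<^sup>2)" for i
  have r0: "0 \<le> r i" for i by (simp add: r_def sum_nonneg)
  have G0: "0 \<le> G" by (simp add: G sum_nonneg)
  have qr: "pmf q i = (if i < N then r i / G else 0)" for i by (simp add: q r_def)
  note E = expectation_finite_nat(1)[OF qr] and supp = expectation_finite_nat(2)[OF qr]
  have "G \<noteq> 0" using set_pmf_not_empty[of q] supp by auto
  with G0 have Gpos: "0 < G" by simp
  \<comment> \<open>An index of probability 0 enters the mean with a quotient by 0, which is 0. The
    estimator stays unbiased because the true term is 0 as well.\<close>
  have fz: "f i a = 0" if "i < N" "a < A" "r i = 0" for i a
    using that by (simp add: r_def sum_nonneg_eq_0_iff)
  have finq: "finite (set_pmf q)" by (simp add: supp)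
  let ?P = "Pi_pmf {..<p} 0 (\<lambda>_. q)"
  have finP: "finite (set_pmf ?P)"
    using finq by (simp add: set_Pi_pmf finite_PiE_dflt)
  have int: "integrable ?P g" for g :: "(nat \<Rightarrow> nat) \<Rightarrow> real"
    by (rule integrable_measure_pmf_finite[OF finP])
  define \<mu> where "\<mu> a b = (\<Sum>i<N. f i a * f i b)" for a b
  define h where "h a b i = \<mu> a b - f i a * f i b / pmf q i" for a b i
  have mean: "measure_pmf.expectation q (\<lambda>i. f i a * f i b / pmf q i) = \<mu> a b" if "a < A" "b < A" for a b
    unfolding E \<mu>_def using Gpos fz that by (intro sum.cong refl) (auto simp: qr)
  have h0: "measure_pmf.expectation q (h a b) = 0" if "a < A" "b < A" for a b
    using mean[OF that] unfolding h_def
    by (subst Bochner_Integration.integral_diff) (auto intro: integrable_measure_pmf_finite finq)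
  have h2: "measure_pmf.expectation q (\<lambda>i. (h a b i)\<^sup>2)
      \<le> (\<Sum>i<N. pmf q i * (f i a * f i b / pmf q i)\<^sup>2)" if "a < A" "b < A" for a b
  proof -
    have "(h a b i)\<^sup>2 = (f i a * f i b / pmf q i)\<^sup>2 - 2 * \<mu> a b * (f i a * f i b / pmf q i) + (\<mu> a b)\<^sup>2" for i
      by (simp add: h_def power2_diff mult.commute mult.left_commute)
    then have "measure_pmf.expectation q (\<lambda>i. (h a b i)\<^sup>2)
      = measure_pmf.expectation q (\<lambda>i. (f i a * f i b / pmf q i)\<^sup>2 - 2 * \<mu> a b * (f i a * f i b / pmf q i) + (\<mu> a b)\<^sup>2)"
      by simp
    also have "\<dots> = measure_pmf.expectation q (\<lambda>i. (f i a * f i b / pmf q i)\<^sup>2)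
        - 2 * \<mu> a b * measure_pmf.expectation q (\<lambda>i. f i a * f i b / pmf q i) + (\<mu> a b)\<^sup>2"
      by (subst Bochner_Integration.integral_add, (rule integrable_measure_pmf_finite[OF finq])+,
          subst Bochner_Integration.integral_diff, (rule integrable_measure_pmf_finite[OF finq])+)
        (simp del: times_divide_eq_right)
    \<comment> \<open>The two terms in \<open>\<mu> a b\<close> add up to
      \<open>- (\<mu> a b)\<^sup>2\<close>, which is dropped.\<close>
    also have "\<dots> \<le> measure_pmf.expectation q (\<lambda>i. (f i a * f i b / pmf q i)\<^sup>2)"
      using mean[OF that] by (simp add: power2_eq_square)
    also have "\<dots> = (\<Sum>i<N. pmf q i * (f i a * f i b / pmf q i)\<^sup>2)"
      unfolding E by (intro sum.cong) (auto simp: qr)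
    finally show ?thesis .
  qed
  have "measure_pmf.expectation ?P
      (\<lambda>x. \<Sum>a<A. \<Sum>b<A. (\<mu> a b - (\<Sum>t<p. f (x t) a * f (x t) b / (real p * pmf q (x t))))\<^sup>2)
    = measure_pmf.expectation ?P (\<lambda>x. \<Sum>a<A. \<Sum>b<A. (1 / (real p)\<^sup>2) * (\<Sum>t<p. h a b (x t))\<^sup>2)"
  proof (intro arg_cong[where f = "measure_pmf.expectation ?P"] ext sum.cong refl)
    fix x :: "nat \<Rightarrow> nat" and a b
    have "(\<Sum>t<p. h a b (x t)) = real p * \<mu> a b - (\<Sum>t<p. f (x t) a * f (x t) b / pmf q (x t))"
      by (simp add: h_def sum_subtractf)
    also have "\<dots> = real p * (\<mu> a b - (\<Sum>t<p. f (x t) a * f (x t) b / (real p * pmf q (x t))))"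
      using p by (simp add: right_diff_distrib sum_distrib_left)
    finally show "(\<mu> a b - (\<Sum>t<p. f (x t) a * f (x t) b / (real p * pmf q (x t))))\<^sup>2
      = 1 / (real p)\<^sup>2 * (\<Sum>t<p. h a b (x t))\<^sup>2"
      using p by (simp add: power_mult_distrib)
  qed
  also have "\<dots> = (\<Sum>a<A. \<Sum>b<A. (1 / (real p)\<^sup>2) * measure_pmf.expectation ?P (\<lambda>x. (\<Sum>t<p. h a b (x t))\<^sup>2))"
    by ((subst Bochner_Integration.integral_sum, rule int)+) simp
  also have "\<dots> = (\<Sum>a<A. \<Sum>b<A. (1 / real p) * measure_pmf.expectation q (\<lambda>i. (h a b i)\<^sup>2))"
    using p by (intro sum.cong refl, subst expectation_sum_sq_Pi_pmf[OF finite_lessThan finq h0])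
      (auto simp: power2_eq_square[of "real p"])
  also have "\<dots> \<le> (\<Sum>a<A. \<Sum>b<A. (1 / real p) * (\<Sum>i<N. pmf q i * (f i a * f i b / pmf q i)\<^sup>2))"
    using h2 by (intro sum_mono mult_left_mono) auto
  also have "\<dots> = (1 / real p) * (\<Sum>i<N. \<Sum>a<A. \<Sum>b<A. pmf q i * (f i a * f i b / pmf q i)\<^sup>2)"
  proof -
    have "(\<Sum>a<A. \<Sum>b<A. \<Sum>i<N. g a b i) = (\<Sum>i<N. \<Sum>a<A. \<Sum>b<A. g a b i)"
      for g :: "nat \<Rightarrow> nat \<Rightarrow> nat \<Rightarrow> real"
      by (subst (2) sum.swap, subst sum.swap) (rule refl)
    then show ?thesis by (simp only: sum_distrib_left)
  qed
  \<comment> \<open>With weight \<open>r i / G\<close>, the summand of index \<open>i\<close> is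
    \<open>(f i a)\<^sup>2 * (f i b)\<^sup>2 * G / r i\<close>, and the double sum over
    \<open>a\<close> and \<open>b\<close> of the squares is \<open>r i * r i\<close>.\<close>
  also have "(\<Sum>i<N. \<Sum>a<A. \<Sum>b<A. pmf q i * (f i a * f i b / pmf q i)\<^sup>2) = (\<Sum>i<N. G * r i)"
  proof (intro sum.cong refl)
    fix i assume "i \<in> {..<N}"
    then have i: "i < N" by simp
    show "(\<Sum>a<A. \<Sum>b<A. pmf q i * (f i a * f i b / pmf q i)\<^sup>2) = G * r i"
    proof (cases "r i = 0")
      case True
      then show ?thesis by (simp add: qr)
    next
      case False
      have "(\<Sum>a<A. \<Sum>b<A. pmf q i * (f i a * f i b / pmf q i)\<^sup>2)
          = (\<Sum>a<A. \<Sum>b<A. (f i a)\<^sup>2 * (f i b)\<^sup>2 * (G / r i))"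
        using i False Gpos by (simp add: qr power2_eq_square field_simps)
      also have "\<dots> = r i * r i * (G / r i)"
      proof -
        have "r i * r i = (\<Sum>a<A. \<Sum>b<A. (f i a)\<^sup>2 * (f i b)\<^sup>2)"
          by (simp only: r_def sum_product)
        then show ?thesis by (simp only: sum_distrib_right)
      qed
      finally show ?thesis using False by simp
    qed
  qed
  also have "(1 / real p) * (\<Sum>i<N. G * r i) = G\<^sup>2 / real p"
    by (simp add: sum_distrib_left[symmetric] G r_def power2_eq_square)
  finally show ?thesis by (simp add: \<mu>_def)
qed

section \<open>Markov's inequality for two dependent sampling stages\<close>

lemma prob_bind_pmf_le:
  assumes fin: "finite (set_pmf P)"
    and le: "\<And>a. a \<in> set_pmf P \<Longrightarrow> measure_pmf.prob (Q a) A \<le> g a"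
  shows "measure_pmf.prob (bind_pmf P Q) A \<le> measure_pmf.expectation P g"
proof -
  have "ennreal (measure_pmf.prob (bind_pmf P Q) A) = (\<integral>\<^sup>+a. ennreal (measure_pmf.prob (Q a) A) \<partial>P)"
    by (simp add: measure_pmf.emeasure_eq_measure[symmetric] emeasure_bind_pmf)
  also have "\<dots> = ennreal (measure_pmf.expectation P (\<lambda>a. measure_pmf.prob (Q a) A))"
    by (intro nn_integral_eq_integral integrable_measure_pmf_finite fin) auto
  finally have "measure_pmf.prob (bind_pmf P Q) A = measure_pmf.expectation P (\<lambda>a. measure_pmf.prob (Q a) A)"
    by (subst (asm) ennreal_inj) (auto intro!: integral_nonneg_AE)
  also have "\<dots> \<le> measure_pmf.expectation P g"
    using le by (intro integral_mono_AE integrable_measure_pmf_finite fin) (auto simp: AE_measure_pmf_iff)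
  finally show ?thesis .
qed

text \<open>The law of the second stage depends on the outcome of the first, so Markov's inequality
  for \<open>X a + Y a b\<close> is applied conditionally on \<open>a\<close>, where
  \<open>X a\<close> is a constant, and the result is then averaged over \<open>a\<close>. Each
  stage contributes one \<open>B\<close>.\<close>

lemma two_stage_markov:
  fixes X :: "'a \<Rightarrow> real" and Y :: "'a \<Rightarrow> 'b \<Rightarrow> real"
  assumes finP: "finite (set_pmf P)" and finQ: "\<And>a. a \<in> set_pmf P \<Longrightarrow> finite (set_pmf (Q a))"
    and X: "\<And>a. 0 \<le> X a" "measure_pmf.expectation P X \<le> B"
    and Y: "\<And>a b. 0 \<le> Y a b" "\<And>a. a \<in> set_pmf P \<Longrightarrow> measure_pmf.expectation (Q a) (Y a) \<le> B"
    and c: "0 < c"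
    and good: "\<And>a b. \<lbrakk>a \<in> set_pmf P; b \<in> set_pmf (Q a); X a + Y a b \<le> c\<rbrakk> \<Longrightarrow> out a b \<in> G"
  shows "1 - 2 * B / c \<le>
    measure_pmf.prob (bind_pmf P (\<lambda>a. bind_pmf (Q a) (\<lambda>b. return_pmf (out a b)))) G"
proof -
  let ?J = "bind_pmf P (\<lambda>a. bind_pmf (Q a) (\<lambda>b. return_pmf (out a b)))"
  have inner: "measure_pmf.prob (bind_pmf (Q a) (\<lambda>b. return_pmf (out a b))) (- G) \<le> (X a + B) / c"
    if a: "a \<in> set_pmf P" for a
  proof -
    have "measure_pmf.prob (bind_pmf (Q a) (\<lambda>b. return_pmf (out a b))) (- G)
        \<le> measure_pmf.expectation (Q a) (\<lambda>b. (X a + Y a b) / c)"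
    proof (rule prob_bind_pmf_le[OF finQ[OF a]])
      \<comment> \<open>Markov pointwise: an outcome outside \<open>G\<close> has a sum above
        \<open>c\<close>, so the quotient exceeds the probability 1 of failure.\<close>
      fix b assume b: "b \<in> set_pmf (Q a)"
      show "measure_pmf.prob (return_pmf (out a b)) (- G) \<le> (X a + Y a b) / c"
        using good[OF a b] c X(1)[of a] Y(1)[of a b]
        by (cases "X a + Y a b \<le> c") (auto simp: measure_return indicator_def)
    qed
    also have "\<dots> = (X a + measure_pmf.expectation (Q a) (Y a)) / c"
      by (simp add: integrable_measure_pmf_finite[OF finQ[OF a]])
    also have "\<dots> \<le> (X a + B) / c" using Y(2)[OF a] c by (intro divide_right_mono) auto
    finally show ?thesis .
  qed
  have "measure_pmf.prob ?J (- G) \<le> measure_pmf.expectation P (\<lambda>a. (X a + B) / c)"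
    by (rule prob_bind_pmf_le[OF finP inner])
  also have "\<dots> = (measure_pmf.expectation P X + B) / c"
    by (simp add: integrable_measure_pmf_finite[OF finP])
  also have "\<dots> \<le> 2 * B / c" using X(2) c by (intro divide_right_mono) auto
  finally show ?thesis
    using measure_pmf.prob_compl[of G ?J] by (simp add: Compl_eq_Diff_UNIV)
qed

section \<open>Singular value decompositions\<close>

lemma vec_norm2_nonneg [simp]: "0 \<le> vec_norm2 v"
  by (simp add: vec_norm2_def)

lemma vec_norm2_sq: "(vec_norm2 v)\<^sup>2 = (\<Sum>i<dim_vec v. (v $ i)\<^sup>2)"
  by (simp add: vec_norm2_def L2_set_def sum_nonneg)

lemma vec_norm2_sq_scalar: "(vec_norm2 v)\<^sup>2 = v \<bullet> v"
  by (simp only: vec_norm2_sq) (simp add: scalar_prod_def power2_eq_square atLeast0LessThan)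

lemma vec_norm2_unit_vec: "i < n \<Longrightarrow> vec_norm2 (unit_vec n i) = 1"
  by (rule power2_eq_imp_eq) (auto simp: vec_norm2_sq_scalar)

lemma vec_norm2_pos:
  assumes "v \<in> carrier_vec n" "v \<noteq> 0\<^sub>v n"
  shows "0 < vec_norm2 v"
proof -
  have "\<exists>i<n. v $ i \<noteq> 0" using assms by (auto simp: vec_eq_iff)
  then have "vec_norm2 v \<noteq> 0"
    using assms by (auto simp: vec_norm2_def L2_set_eq_0_iff)
  then show ?thesis by (simp add: order_less_le)
qed

lemma scalar_prod_le_norms:
  assumes "dim_vec v = dim_vec w"
  shows "\<bar>v \<bullet> w\<bar> \<le> vec_norm2 v * vec_norm2 w"
proof -
  have "\<bar>v \<bullet> w\<bar> \<le> (\<Sum>i<dim_vec w. \<bar>v $ i\<bar> * \<bar>w $ i\<bar>)"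
    unfolding scalar_prod_def atLeast0LessThan
    by (rule order_trans[OF sum_abs]) (simp add: abs_mult)
  also have "\<dots> \<le> vec_norm2 v * vec_norm2 w"
    unfolding vec_norm2_def assms by (rule L2_set_mult_ineq)
  finally show ?thesis .
qed

lemma vec_norm2_add_le:
  assumes "dim_vec v = dim_vec w"
  shows "vec_norm2 (v + w) \<le> vec_norm2 v + vec_norm2 w"
proof -
  have "vec_norm2 (v + w) = L2_set (\<lambda>i. v $ i + w $ i) {..<dim_vec w}"
    by (simp add: vec_norm2_def L2_set_def)
  then show ?thesis
    using L2_set_triangle_ineq[of "\<lambda>i. v $ i" "\<lambda>i. w $ i" "{..<dim_vec w}"] assms
    by (simp add: vec_norm2_def)
qed

lemma vec_norm2_smult: "vec_norm2 (c \<cdot>\<^sub>v v) = \<bar>c\<bar> * vec_norm2 v"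
  by (simp add: vec_norm2_def L2_set_def power_mult_distrib sum_distrib_left[symmetric] real_sqrt_mult)

lemma vec_norm2_uminus: "vec_norm2 (- v) = vec_norm2 v"
  by (simp add: vec_norm2_def L2_set_def)

lemma vec_norm2_diff_le:
  assumes "v \<in> carrier_vec n" "w \<in> carrier_vec n"
  shows "vec_norm2 (v - w) \<le> vec_norm2 v + vec_norm2 w"
  using vec_norm2_add_le[of v "- w"] assms
  by (simp add: vec_norm2_uminus minus_add_uminus_vec[OF assms])

lemma frob_norm_nonneg [simp]: "0 \<le> frob_norm M"
  by (simp add: frob_norm_def)

lemma frob_norm_sq_entries: "(frob_norm M)\<^sup>2 = (\<Sum>i<dim_row M. \<Sum>j<dim_col M. (M $$ (i, j))\<^sup>2)"
  unfolding frob_norm_sq vec_norm2_sq by (intro sum.cong) auto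

lemma frob_norm_transpose: "frob_norm (transpose_mat M) = frob_norm M"
proof (rule power2_eq_imp_eq)
  show "(frob_norm (transpose_mat M))\<^sup>2 = (frob_norm M)\<^sup>2"
    unfolding frob_norm_sq_entries
    by simp (subst sum.swap, rule refl)
qed simp_all

text \<open>Cauchy-Schwarz in every row. Through it, Frobenius errors, which sampling controls in
  expectation, act as operator norm errors.\<close>

lemma vec_norm2_mult_mat_le:
  assumes "M \<in> carrier_mat a n" "x \<in> carrier_vec n"
  shows "vec_norm2 (M *\<^sub>v x) \<le> frob_norm M * vec_norm2 x"
proof (rule power2_le_imp_le)
  have "(vec_norm2 (M *\<^sub>v x))\<^sup>2 = (\<Sum>i<a. (row M i \<bullet> x)\<^sup>2)"
    using assms by (simp add: vec_norm2_sq)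
  also have "\<dots> \<le> (\<Sum>i<a. (vec_norm2 (row M i))\<^sup>2 * (vec_norm2 x)\<^sup>2)"
  proof (rule sum_mono)
    fix i
    have "\<bar>row M i \<bullet> x\<bar> \<le> vec_norm2 (row M i) * vec_norm2 x"
      using assms by (intro scalar_prod_le_norms) auto
    then show "(row M i \<bullet> x)\<^sup>2 \<le> (vec_norm2 (row M i))\<^sup>2 * (vec_norm2 x)\<^sup>2"
      using abs_le_square_iff[of "row M i \<bullet> x" "vec_norm2 (row M i) * vec_norm2 x"]
      by (simp add: power_mult_distrib abs_mult)
  qed
  also have "\<dots> = (frob_norm M * vec_norm2 x)\<^sup>2"
    using assms by (simp add: frob_norm_sq sum_distrib_right power_mult_distrib)
  finally show "(vec_norm2 (M *\<^sub>v x))\<^sup>2 \<le> (frob_norm M * vec_norm2 x)\<^sup>2" .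
qed simp

lemma scalar_prod_mult_mat_vec:
  fixes M :: "real mat"
  assumes "M \<in> carrier_mat a n" "x \<in> carrier_vec n" "y \<in> carrier_vec a"
  shows "(M *\<^sub>v x) \<bullet> y = x \<bullet> (transpose_mat M *\<^sub>v y)"
  using transpose_vec_mult_scalar[OF assms] assms
  by (metis comm_scalar_prod mult_mat_vec_carrier transpose_carrier_mat)

lemma vec_norm2_mult_mat_sq:
  assumes "M \<in> carrier_mat a n" "x \<in> carrier_vec n"
  shows "(vec_norm2 (M *\<^sub>v x))\<^sup>2 = x \<bullet> (transpose_mat M * M *\<^sub>v x)"
  using assms scalar_prod_mult_mat_vec[OF assms, of "M *\<^sub>v x"]
  by (simp add: vec_norm2_sq_scalar assoc_mult_mat_vec[OF _ assms])

text \<open>The difference of the squared norms is the quadratic form of the difference of the Gram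
  matrices. It is used once for \<open>C\<close> against \<open>S\<close> and once for the
  transposes of \<open>S\<close> and \<open>W\<close>.\<close>

lemma gram_difference_bound:
  assumes M: "M \<in> carrier_mat a n" and M': "M' \<in> carrier_mat a' n"
    and x: "x \<in> carrier_vec n"
    and bound: "frob_norm (transpose_mat M * M - transpose_mat M' * M') \<le> \<kappa>"
  shows "\<bar>(vec_norm2 (M *\<^sub>v x))\<^sup>2 - (vec_norm2 (M' *\<^sub>v x))\<^sup>2\<bar> \<le> \<kappa> * (vec_norm2 x)\<^sup>2"
proof -
  let ?E = "transpose_mat M * M - transpose_mat M' * M'"
  have G: "transpose_mat M * M \<in> carrier_mat n n" and G': "transpose_mat M' * M' \<in> carrier_mat n n"
    using M M' by auto
  have "(vec_norm2 (M *\<^sub>v x))\<^sup>2 - (vec_norm2 (M' *\<^sub>v x))\<^sup>2 = x \<bullet> (?E *\<^sub>v x)"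
    using G G' x by (simp add: vec_norm2_mult_mat_sq[OF M x] vec_norm2_mult_mat_sq[OF M' x]
        minus_mult_distrib_mat_vec[OF G G' x] scalar_prod_minus_distrib[of _ n])
  also have "\<bar>x \<bullet> (?E *\<^sub>v x)\<bar> \<le> vec_norm2 x * vec_norm2 (?E *\<^sub>v x)"
    using G' x by (intro scalar_prod_le_norms) auto
  also have "\<dots> \<le> vec_norm2 x * (\<kappa> * vec_norm2 x)"
  proof (intro mult_left_mono vec_norm2_nonneg)
    have "?E \<in> carrier_mat n n" by (rule minus_carrier_mat[OF G'])
    then have "vec_norm2 (?E *\<^sub>v x) \<le> frob_norm ?E * vec_norm2 x"
      using x by (rule vec_norm2_mult_mat_le)
    also have "\<dots> \<le> \<kappa> * vec_norm2 x"
      using bound by (intro mult_right_mono) auto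
    finally show "vec_norm2 (?E *\<^sub>v x) \<le> \<kappa> * vec_norm2 x" .
  qed
  finally show ?thesis by (simp add: power2_eq_square mult_ac)
qed

section \<open>Norm bounds read off from a singular value decomposition\<close>

lemma orthogonal_mult_transpose:
  fixes V :: "real mat"
  assumes "V \<in> carrier_mat N N" "transpose_mat V * V = 1\<^sub>m N"
  shows "V * transpose_mat V = 1\<^sub>m N"
  using mat_mult_left_right_inverse[of "transpose_mat V" N V] assms by simp

lemma vec_norm2_isometry:
  assumes "V \<in> carrier_mat a n" "transpose_mat V * V = 1\<^sub>m n" "x \<in> carrier_vec n"
  shows "vec_norm2 (V *\<^sub>v x) = vec_norm2 x"
proof (rule power2_eq_imp_eq)
  show "(vec_norm2 (V *\<^sub>v x))\<^sup>2 = (vec_norm2 x)\<^sup>2"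
    unfolding vec_norm2_mult_mat_sq[OF assms(1,3)] using assms by (simp add: vec_norm2_sq_scalar)
qed simp_all

text \<open>Lets every fact about right singular vectors be used for left ones.\<close>

lemma is_svd_transpose:
  assumes "is_svd M (U, s, V)"
  shows "is_svd (transpose_mat M) (V, s, U)"
proof -
  let ?D = "Matrix.mat (dim_row M) (dim_col M) (\<lambda>(i, j). if i = j then s (i + 1) else 0)"
  let ?D' = "Matrix.mat (dim_col M) (dim_row M) (\<lambda>(i, j). if i = j then s (i + 1) else 0)"
  have U: "U \<in> carrier_mat (dim_row M) (dim_row M)" and V: "V \<in> carrier_mat (dim_col M) (dim_col M)"
    and M: "M = U * ?D * transpose_mat V"
    using assms by auto
  have "transpose_mat ?D = ?D'" by (intro eq_matI) auto
  then have "transpose_mat (U * ?D * transpose_mat V) = V * (?D' * transpose_mat U)"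
    using U V transpose_mult[of "U * ?D" "dim_row M" "dim_col M" "transpose_mat V" "dim_col M"]
      transpose_mult[of U "dim_row M" "dim_row M" ?D "dim_col M"]
    by simp
  then have "transpose_mat M = V * ?D' * transpose_mat U"
    using U V M assoc_mult_mat[of V "dim_col M" "dim_col M" ?D' "dim_row M" "transpose_mat U" "dim_row M"]
    by simp
  then show ?thesis
    using assms unfolding is_svd.simps index_transpose_mat min.commute[of "dim_col M"] by blast
qed

text \<open>Since \<open>s\<close> counts from 1 and columns count from 0, column \<open>j\<close>
  of \<open>U\<close> and of \<open>V\<close> belongs to \<open>s (j + 1)\<close>.\<close>

locale svd_decomposition =
  fixes M U V :: "real mat" and s :: "nat \<Rightarrow> real" and a n :: nat
  assumes M: "M \<in> carrier_mat a n" and svd: "is_svd M (U, s, V)"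
begin

lemma U: "U \<in> carrier_mat a a" and V: "V \<in> carrier_mat n n"
  and UTU: "transpose_mat U * U = 1\<^sub>m a" and VTV: "transpose_mat V * V = 1\<^sub>m n"
  and s_nonneg: "i \<in> {1..min a n} \<Longrightarrow> 0 \<le> s i"
  using M svd by auto

lemma s_antimono: "\<lbrakk>1 \<le> i; i \<le> j; j \<le> min a n\<rbrakk> \<Longrightarrow> s j \<le> s i"
proof -
  assume *: "1 \<le> i" "i \<le> j" "j \<le> min a n"
  have "antimono_on {1..min a n} s" using M svd by auto
  then show "s j \<le> s i" using * by (auto simp: monotone_on_def)
qed

lemma s_sq_antimono: "\<lbrakk>1 \<le> i; i \<le> j; j \<le> min a n\<rbrakk> \<Longrightarrow> (s j)\<^sup>2 \<le> (s i)\<^sup>2"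
  by (intro power_mono s_antimono s_nonneg) auto

lemma norm_VT: "x \<in> carrier_vec n \<Longrightarrow> vec_norm2 (transpose_mat V *\<^sub>v x) = vec_norm2 x"
  using vec_norm2_isometry[of "transpose_mat V" n n x] V orthogonal_mult_transpose[OF V VTV]
  by simp

definition "D = Matrix.mat a n (\<lambda>(i, j). if i = j then s (i + 1) else 0)"

lemma D: "D \<in> carrier_mat a n" by (simp add: D_def)

lemma M_eq: "M = U * D * transpose_mat V"
  using M svd unfolding D_def by auto

lemma D_mult_vec:
  assumes "y \<in> carrier_vec n" "i < a"
  shows "(D *\<^sub>v y) $ i = (if i < n then s (i + 1) * y $ i else 0)"
proof -
  have "(D *\<^sub>v y) $ i = (\<Sum>j<n. (if i = j then s (i + 1) else 0) * y $ j)"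
    using assms by (simp add: D_def scalar_prod_def atLeast0LessThan)
  also have "\<dots> = (\<Sum>j<n. if i = j then s (i + 1) * y $ j else 0)"
    by (intro sum.cong) auto
  also have "\<dots> = (if i < n then s (i + 1) * y $ i else 0)" by simp
  finally show ?thesis .
qed

lemma M_mult_vec: "x \<in> carrier_vec n \<Longrightarrow> M *\<^sub>v x = U *\<^sub>v (D *\<^sub>v (transpose_mat V *\<^sub>v x))"
  unfolding M_eq using U D V
  by (simp add: assoc_mult_mat_vec[of _ a n _ n] assoc_mult_mat_vec[of _ a a _ n])

text \<open>In the coordinates of \<open>x\<close> with respect to the right singular vectors,
  \<open>M\<close> acts diagonally, followed by the isometry \<open>U\<close>.\<close>

lemma norm_M_sq:
  assumes "x \<in> carrier_vec n"
  shows "(vec_norm2 (M *\<^sub>v x))\<^sup>2 = (\<Sum>j<min a n. (s (j + 1))\<^sup>2 * ((transpose_mat V *\<^sub>v x) $ j)\<^sup>2)"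
proof -
  have c: "transpose_mat V *\<^sub>v x \<in> carrier_vec n" using V assms by auto
  have "(vec_norm2 (M *\<^sub>v x))\<^sup>2 = (vec_norm2 (D *\<^sub>v (transpose_mat V *\<^sub>v x)))\<^sup>2"
    using M_mult_vec[OF assms] vec_norm2_isometry[OF U UTU] D c by simp
  also have "\<dots> = (\<Sum>i<a. if i < n then (s (i + 1))\<^sup>2 * ((transpose_mat V *\<^sub>v x) $ i)\<^sup>2 else 0)"
    using D by (auto simp: vec_norm2_sq D_mult_vec[OF c] power_mult_distrib
        simp del: index_mult_mat_vec intro!: sum.cong)
  also have "\<dots> = (\<Sum>i\<in>{..<a} \<inter> {i. i < n}. (s (i + 1))\<^sup>2 * ((transpose_mat V *\<^sub>v x) $ i)\<^sup>2)"
    by (subst sum.inter_restrict) auto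
  also have "{..<a} \<inter> {i. i < n} = {..<min a n}" by auto
  finally show ?thesis .
qed

lemma col_V: "j < n \<Longrightarrow> transpose_mat V *\<^sub>v col V j = unit_vec n j"
proof -
  assume j: "j < n"
  have "transpose_mat V *\<^sub>v col V j = col (transpose_mat V * V) j"
    using V j by (intro col_mult2[symmetric]) auto
  then show ?thesis using VTV j by simp
qed

lemma M_col_V: "j < min a n \<Longrightarrow> M *\<^sub>v col V j = s (j + 1) \<cdot>\<^sub>v col U j"
proof -
  assume j: "j < min a n"
  have "D *\<^sub>v unit_vec n j = s (j + 1) \<cdot>\<^sub>v unit_vec a j"
    using j D by (intro eq_vecI) (auto simp: D_mult_vec simp del: index_mult_mat_vec)
  then have "M *\<^sub>v col V j = U *\<^sub>v (s (j + 1) \<cdot>\<^sub>v unit_vec a j)"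
    using j V M_mult_vec[of "col V j"] col_V[of j] by (simp add: carrier_vecI)
  also have "\<dots> = s (j + 1) \<cdot>\<^sub>v (U *\<^sub>v unit_vec a j)"
    using U by (intro mult_mat_vec[of _ a a]) auto
  also have "U *\<^sub>v unit_vec a j = col U j"
    using j U by (intro eq_vecI) auto
  finally show ?thesis .
qed

text \<open>One half of the Courant-Fischer principle: on the span of the first \<open>d\<close>
  right singular vectors no coordinate is scaled by less than \<open>s d\<close>.\<close>

lemma norm_M_ge:
  assumes x: "x \<in> carrier_vec n" and d: "1 \<le> d" "d \<le> min a n"
    and zero: "\<And>j. d \<le> j \<Longrightarrow> j < n \<Longrightarrow> (transpose_mat V *\<^sub>v x) $ j = 0"
  shows "s d * vec_norm2 x \<le> vec_norm2 (M *\<^sub>v x)"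
proof (rule power2_le_imp_le)
  let ?y = "transpose_mat V *\<^sub>v x"
  have "(s d * vec_norm2 x)\<^sup>2 = (s d)\<^sup>2 * (vec_norm2 ?y)\<^sup>2"
    using x by (simp add: norm_VT power_mult_distrib)
  also have "\<dots> = (s d)\<^sup>2 * (\<Sum>j<n. (?y $ j)\<^sup>2)"
    using V by (simp add: vec_norm2_sq)
  also have "(\<Sum>j<n. (?y $ j)\<^sup>2) = (\<Sum>j<d. (?y $ j)\<^sup>2)"
    using d zero by (intro sum.mono_neutral_right) auto
  also have "(s d)\<^sup>2 * \<dots> \<le> (\<Sum>j<d. (s (j + 1))\<^sup>2 * (?y $ j)\<^sup>2)"
    unfolding sum_distrib_left using d
    by (intro sum_mono mult_right_mono s_sq_antimono) auto
  also have "\<dots> \<le> (\<Sum>j<min a n. (s (j + 1))\<^sup>2 * (?y $ j)\<^sup>2)"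
    using d by (intro sum_mono2) auto
  also have "\<dots> = (vec_norm2 (M *\<^sub>v x))\<^sup>2"
    using x by (simp add: norm_M_sq)
  finally show "(s d * vec_norm2 x)\<^sup>2 \<le> (vec_norm2 (M *\<^sub>v x))\<^sup>2" .
qed simp

text \<open>The other half of Courant-Fischer. Only the first \<open>d - 1\<close> coordinates have
  to vanish, since the coordinate of index \<open>d - 1\<close> is the one scaled by
  \<open>s d\<close>.\<close>

lemma norm_M_le:
  assumes x: "x \<in> carrier_vec n" and d: "1 \<le> d" "d \<le> min a n"
    and zero: "\<And>j. j < d - 1 \<Longrightarrow> (transpose_mat V *\<^sub>v x) $ j = 0"
  shows "vec_norm2 (M *\<^sub>v x) \<le> s d * vec_norm2 x"
proof (rule power2_le_imp_le)
  let ?y = "transpose_mat V *\<^sub>v x"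
  have "(vec_norm2 (M *\<^sub>v x))\<^sup>2 = (\<Sum>j<min a n. (s (j + 1))\<^sup>2 * (?y $ j)\<^sup>2)"
    using x by (simp add: norm_M_sq)
  also have "\<dots> \<le> (\<Sum>j<min a n. (s d)\<^sup>2 * (?y $ j)\<^sup>2)"
  proof (rule sum_mono)
    fix j assume "j \<in> {..<min a n}"
    then show "(s (j + 1))\<^sup>2 * (?y $ j)\<^sup>2 \<le> (s d)\<^sup>2 * (?y $ j)\<^sup>2"
      using zero[of j] d by (cases "j < d - 1") (auto intro!: mult_right_mono s_sq_antimono)
  qed
  \<comment> \<open>The added coordinates, present if \<open>a < n\<close>, belong to the kernel of
    \<open>M\<close>; they only enlarge the bound.\<close>
  also have "\<dots> \<le> (\<Sum>j<n. (s d)\<^sup>2 * (?y $ j)\<^sup>2)"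
    by (intro sum_mono2) auto
  also have "\<dots> = (s d)\<^sup>2 * (vec_norm2 ?y)\<^sup>2"
    using V by (simp add: vec_norm2_sq sum_distrib_left)
  also have "\<dots> = (s d * vec_norm2 x)\<^sup>2"
    using x by (simp add: norm_VT power_mult_distrib)
  finally show "(vec_norm2 (M *\<^sub>v x))\<^sup>2 \<le> (s d * vec_norm2 x)\<^sup>2" .
  show "0 \<le> s d * vec_norm2 x" using d s_nonneg by simp
qed

end

text \<open>Dimension count by determinants: padded with zero rows, \<open>K\<close> becomes a
  square matrix with a zero row, which has no right inverse and hence has determinant 0.\<close>

lemma exists_kernel_vector:
  fixes K :: "real mat"
  assumes K: "K \<in> carrier_mat r d" and r: "r < d"
  obtains z where "z \<in> carrier_vec d" "z \<noteq> 0\<^sub>v d" "K *\<^sub>v z = 0\<^sub>v r"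
proof -
  define L where "L = Matrix.mat d d (\<lambda>(i, j). if i < r then K $$ (i, j) else 0)"
  have L: "L \<in> carrier_mat d d" by (simp add: L_def)
  have "Determinant.det L = 0"
  proof (rule ccontr)
    assume "Determinant.det L \<noteq> 0"
    then obtain B where B: "B \<in> carrier_mat d d" "L * B = 1\<^sub>m d"
      using det_non_zero_imp_unit[OF L] by (auto simp: Units_def ring_mat_def)
    have "row L r = 0\<^sub>v d"
      using r by (intro eq_vecI) (auto simp: L_def)
    then have "(L * B) $$ (r, r) = 0"
      using L B(1) r by simp
    then show False using B(2) r by simp
  qed
  then obtain z where z: "z \<in> carrier_vec d" "z \<noteq> 0\<^sub>v d" "L *\<^sub>v z = 0\<^sub>v d"
    using det_0_iff_vec_prod_zero[OF L] by auto
  have "K *\<^sub>v z = 0\<^sub>v r"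
  proof (rule eq_vecI)
    fix i assume "i < dim_vec (0\<^sub>v r :: real vec)"
    then have i: "i < r" by simp
    have "row K i = row L i" using i K r by (intro eq_vecI) (auto simp: L_def)
    then have "(K *\<^sub>v z) $ i = (L *\<^sub>v z) $ i" using i r K L by simp
    then show "(K *\<^sub>v z) $ i = 0\<^sub>v r $ i" using z i r by simp
  qed (use K in auto)
  then show thesis using z that by blast
qed

section \<open>Perturbation by two-sided sketching\<close>

text \<open>Both norm estimates are tested on the right singular vector that belongs to
  \<open>s d\<close>.\<close>

lemma (in svd_decomposition) singular_value_le_frob_norm:
  assumes d: "1 \<le> d" "d \<le> min a n"
  shows "s d \<le> frob_norm M"
proof -
  have v: "col V (d - 1) \<in> carrier_vec n" using V by (auto intro: carrier_vecI)
  have "d \<le> n" using d by simp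
  then have j: "d - 1 < n" using d(1) by linarith
  have c: "transpose_mat V *\<^sub>v col V (d - 1) = unit_vec n (d - 1)"
    by (rule col_V[OF j])
  have n1: "vec_norm2 (col V (d - 1)) = 1"
    using norm_VT[OF v] unfolding c vec_norm2_unit_vec[OF j] ..
  have "s d * vec_norm2 (col V (d - 1)) \<le> vec_norm2 (M *\<^sub>v col V (d - 1))"
    by (intro norm_M_ge[OF v]) (unfold c, use d in auto)
  also have "\<dots> \<le> frob_norm M * vec_norm2 (col V (d - 1))"
    by (rule vec_norm2_mult_mat_le[OF M v])
  finally show ?thesis unfolding n1 by simp
qed

text \<open>The setting is deterministic: sampling enters only through the bound \<kappa> on two
  Gram errors. \<open>S\<close> approximates \<open>C\<close> by rows, which preserves
  \<open>C^T C\<close>; \<open>W\<close> approximates \<open>S\<close> by columns, which preserves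
  \<open>S S^T\<close>. The latter is why the left singular vectors \<open>Ub\<close> of
  \<open>W\<close> carry the information.\<close>

locale sketch_perturbation =
  C: svd_decomposition C U V \<sigma> m N + W: svd_decomposition W Ub Vb s p p
  for C U V :: "real mat" and \<sigma> :: "nat \<Rightarrow> real" and m N :: nat
    and W Ub Vb :: "real mat" and s :: "nat \<Rightarrow> real" and p :: nat +
  fixes S :: "real mat" and \<kappa> f :: real
  assumes S: "S \<in> carrier_mat p N" and N_le: "N \<le> m"
    and row_error: "frob_norm (transpose_mat C * C - transpose_mat S * S) \<le> \<kappa>"
    and col_error: "frob_norm (S * transpose_mat S - W * transpose_mat W) \<le> \<kappa>"
    and frob_S: "frob_norm S \<le> f"
begin

lemma \<kappa>_nonneg: "0 \<le> \<kappa>"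
  using row_error frob_norm_nonneg order_trans by blast

sublocale Wt: svd_decomposition "transpose_mat W" Vb Ub s p p
  using W.M is_svd_transpose[OF W.svd] by unfold_locales auto

section \<open>Singular values of the sketch\<close>

lemma row_gram:
  "x \<in> carrier_vec N \<Longrightarrow> \<bar>(vec_norm2 (C *\<^sub>v x))\<^sup>2 - (vec_norm2 (S *\<^sub>v x))\<^sup>2\<bar> \<le> \<kappa> * (vec_norm2 x)\<^sup>2"
  using gram_difference_bound[OF C.M S _ row_error] .

lemma col_gram:
  "u \<in> carrier_vec p \<Longrightarrow>
    \<bar>(vec_norm2 (transpose_mat S *\<^sub>v u))\<^sup>2 - (vec_norm2 (transpose_mat W *\<^sub>v u))\<^sup>2\<bar> \<le> \<kappa> * (vec_norm2 u)\<^sup>2"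
  using gram_difference_bound[of "transpose_mat S" N p "transpose_mat W" p u \<kappa>] S W.M col_error
  by simp

text \<open>
  A Weyl-type bound. The \<open>d\<close>-dimensional space \<open>S v\<^sub>1, \<dots>, S v\<^sub>d\<close> meets the orthogonal complement of
  the first \<open>d - 1\<close> left singular vectors of \<open>W\<close>.
\<close>

lemma sigma_sq_le:
  assumes d: "1 \<le> d" "d \<le> N" "d \<le> p" and big: "\<kappa> < (\<sigma> d)\<^sup>2"
  shows "(\<sigma> d)\<^sup>2 - 2 * \<kappa> \<le> (s d)\<^sup>2"
proof -
  define V\<^sub>d where "V\<^sub>d = Matrix.mat N d (\<lambda>(i, j). V $$ (i, j))"
  have Vd: "V\<^sub>d \<in> carrier_mat N d" by (simp add: V\<^sub>d_def)
  have colVd: "col V\<^sub>d j = col V j" if "j < d" for j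
    using that d C.V by (intro eq_vecI) (auto simp: V\<^sub>d_def)
  have VtVd: "transpose_mat V * V\<^sub>d = Matrix.mat N d (\<lambda>(i, j). if i = j then 1 else 0)"
  proof (rule eq_matI)
    fix i j assume "i < dim_row (Matrix.mat N d (\<lambda>(i, j). if i = j then 1 else 0 :: real))"
      and "j < dim_col (Matrix.mat N d (\<lambda>(i, j). if i = j then 1 else 0 :: real))"
    then have ij: "i < N" "j < d" by auto
    then have "(transpose_mat V * V\<^sub>d) $$ (i, j) = (transpose_mat V * V) $$ (i, j)"
      using d C.V Vd colVd by simp
    then show "(transpose_mat V * V\<^sub>d) $$ (i, j) = Matrix.mat N d (\<lambda>(i, j). if i = j then 1 else 0) $$ (i, j)"
      using ij d by (simp add: C.VTV)
  qed (use C.V Vd in auto)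
  \<comment> \<open>A kernel vector \<open>z\<close> of \<open>K\<close> makes
    \<open>S * V\<^sub>d *\<^sub>v z\<close> orthogonal to the first \<open>d - 1\<close> columns of
    \<open>Ub\<close>: these are \<open>d - 1\<close> equations in \<open>d\<close>
    unknowns.\<close>
  define K where "K = Matrix.mat (d - 1) d (\<lambda>(i, j). (transpose_mat Ub * (S * V\<^sub>d)) $$ (i, j))"
  have "K \<in> carrier_mat (d - 1) d" by (simp add: K_def)
  then obtain z where z: "z \<in> carrier_vec d" "z \<noteq> 0\<^sub>v d" "K *\<^sub>v z = 0\<^sub>v (d - 1)"
    by (rule exists_kernel_vector) (use d in auto)
  define y where "y = V\<^sub>d *\<^sub>v z"
  define u where "u = S *\<^sub>v y"
  have y: "y \<in> carrier_vec N" and u: "u \<in> carrier_vec p"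
    using Vd z S by (auto simp: y_def u_def)
  have Vty: "(transpose_mat V *\<^sub>v y) $ j = (if j < d then z $ j else 0)" if "j < N" for j
  proof -
    have "transpose_mat V *\<^sub>v y = (transpose_mat V * V\<^sub>d) *\<^sub>v z"
      using assoc_mult_mat_vec[OF _ Vd z(1), of "transpose_mat V" N] C.V by (simp add: y_def)
    then have "(transpose_mat V *\<^sub>v y) $ j = (\<Sum>i<d. (if j = i then 1 else 0) * z $ i)"
      using that z(1) unfolding VtVd by (simp add: scalar_prod_def atLeast0LessThan)
    also have "\<dots> = (\<Sum>i<d. if j = i then z $ i else 0)" by (intro sum.cong) auto
    finally show ?thesis by simp
  qed
  have "y \<noteq> 0\<^sub>v N"
  proof
    assume "y = 0\<^sub>v N"
    then have "z $ j = 0" if "j < d" for j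
      using Vty[of j] that d C.V scalar_prod_right_zero[of "col V j" N] by (simp add: carrier_vecI)
    then show False using z by auto
  qed
  then have ypos: "0 < vec_norm2 y" using y by (intro vec_norm2_pos)
  have Cy: "\<sigma> d * vec_norm2 y \<le> vec_norm2 (C *\<^sub>v y)"
    using y d N_le by (intro C.norm_M_ge) (auto simp: Vty simp del: index_mult_mat_vec)
  have "(\<sigma> d)\<^sup>2 * (vec_norm2 y)\<^sup>2 \<le> (vec_norm2 (C *\<^sub>v y))\<^sup>2"
    using power_mono[OF Cy, of 2] C.s_nonneg[of d] d N_le by (simp add: power_mult_distrib)
  then have uy: "((\<sigma> d)\<^sup>2 - \<kappa>) * (vec_norm2 y)\<^sup>2 \<le> (vec_norm2 u)\<^sup>2"
    using row_gram[OF y] by (simp add: u_def left_diff_distrib)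
  have upos: "0 < (vec_norm2 u)\<^sup>2"
    using uy ypos big by (meson diff_gt_0_iff_gt less_le_trans mult_pos_pos zero_less_power)
  \<comment> \<open>Cauchy-Schwarz turns the lower bound for \<open>u = S y\<close> into one for
    \<open>S^T u\<close>: the fourth power of the norm of \<open>u\<close> is at most the product of
    the squared norms of \<open>y\<close> and \<open>S^T u\<close>, and \<open>uy\<close> bounds
    \<open>y\<close> by \<open>u\<close>.\<close>
  have "(vec_norm2 u)\<^sup>2 = y \<bullet> (transpose_mat S *\<^sub>v u)"
    using scalar_prod_mult_mat_vec[OF S y u] by (simp add: u_def vec_norm2_sq_scalar)
  also have "\<dots> \<le> vec_norm2 y * vec_norm2 (transpose_mat S *\<^sub>v u)"
    using scalar_prod_le_norms[of y "transpose_mat S *\<^sub>v u"] y S by auto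
  finally have "((vec_norm2 u)\<^sup>2)\<^sup>2 \<le> (vec_norm2 y * vec_norm2 (transpose_mat S *\<^sub>v u))\<^sup>2"
    by (intro power_mono) auto
  then have "((vec_norm2 u)\<^sup>2)\<^sup>2 * ((\<sigma> d)\<^sup>2 - \<kappa>)
      \<le> (vec_norm2 y)\<^sup>2 * ((\<sigma> d)\<^sup>2 - \<kappa>) * (vec_norm2 (transpose_mat S *\<^sub>v u))\<^sup>2"
    using big by (simp add: power_mult_distrib mult_ac)
  also have "\<dots> \<le> (vec_norm2 u)\<^sup>2 * (vec_norm2 (transpose_mat S *\<^sub>v u))\<^sup>2"
    using uy by (intro mult_right_mono) (auto simp: mult_ac)
  finally have "(vec_norm2 u)\<^sup>2 * ((vec_norm2 u)\<^sup>2 * ((\<sigma> d)\<^sup>2 - \<kappa>))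
      \<le> (vec_norm2 u)\<^sup>2 * (vec_norm2 (transpose_mat S *\<^sub>v u))\<^sup>2"
    by (simp only: power2_eq_square[of "(vec_norm2 u)\<^sup>2"] mult.assoc)
  then have St: "(vec_norm2 u)\<^sup>2 * ((\<sigma> d)\<^sup>2 - \<kappa>) \<le> (vec_norm2 (transpose_mat S *\<^sub>v u))\<^sup>2"
    using upos by (simp only: mult_le_cancel_left_pos)
  have Wt: "vec_norm2 (transpose_mat W *\<^sub>v u) \<le> s d * vec_norm2 u"
  proof (rule Wt.norm_M_le[OF u])
    fix j assume j: "j < d - 1"
    have "transpose_mat Ub *\<^sub>v u = (transpose_mat Ub * (S * V\<^sub>d)) *\<^sub>v z"
      using W.U S Vd z(1) by (simp add: u_def y_def assoc_mult_mat_vec[of _ p p _ d] assoc_mult_mat_vec[of _ p N _ d])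
    moreover have "row (transpose_mat Ub * (S * V\<^sub>d)) j = row K j"
      using j d W.U Vd by (intro eq_vecI) (auto simp: K_def)
    ultimately have "(transpose_mat Ub *\<^sub>v u) $ j = (K *\<^sub>v z) $ j"
      using j d W.U by (simp add: K_def)
    then show "(transpose_mat Ub *\<^sub>v u) $ j = 0" using z j by simp
  qed (use d in auto)
  have "(vec_norm2 (transpose_mat W *\<^sub>v u))\<^sup>2 \<le> (s d)\<^sup>2 * (vec_norm2 u)\<^sup>2"
    using power_mono[OF Wt, of 2] by (simp add: power_mult_distrib)
  \<comment> \<open>One \<kappa> was lost in \<open>St\<close> between \<open>C\<close> and
    \<open>S\<close>; passing from \<open>S^T\<close> to \<open>W^T\<close> loses the
    second.\<close>
  with St col_gram[OF u]
  have "((\<sigma> d)\<^sup>2 - 2 * \<kappa>) * (vec_norm2 u)\<^sup>2 \<le> (s d)\<^sup>2 * (vec_norm2 u)\<^sup>2"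
    by (simp add: algebra_simps)
  then show ?thesis using upos by simp
qed

section \<open>Columns of the QiSVD output as approximate eigenvectors\<close>

text \<open>Column \<open>t\<close> of the QiSVD output, viewed as an approximate eigenvector of
  \<open>C^T C\<close> for the value \<open>(s (t + 1))\<^sup>2\<close>.\<close>

definition ritz :: "nat \<Rightarrow> real vec" where
  "ritz t = (1 / s (t + 1)) \<cdot>\<^sub>v (transpose_mat S *\<^sub>v col Ub t)"

lemma ritz_carrier: "ritz t \<in> carrier_vec N"
  using S by (auto simp: ritz_def intro!: carrier_vecI)

lemma dim_ritz [simp]: "dim_vec (ritz t) = N"
  using ritz_carrier[of t] by auto

definition ritz_mat :: "nat \<Rightarrow> real mat" where
  "ritz_mat d = Matrix.mat N d (\<lambda>(i, t). ritz t $ i)"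

lemma ritz_mat_carrier: "ritz_mat d \<in> carrier_mat N d"
  by (simp add: ritz_mat_def)

lemma col_ritz_mat: "t < d \<Longrightarrow> col (ritz_mat d) t = ritz t"
  by (intro eq_vecI) (auto simp: ritz_mat_def)

text \<open>Collects a combination of Ritz vectors into \<open>S^T\<close> applied to a single
  vector, the form to which \<open>col_gram\<close> applies.\<close>

lemma ritz_mat_mult_vec:
  assumes "d \<le> p" "z \<in> carrier_vec d"
  shows "ritz_mat d *\<^sub>v z = transpose_mat S *\<^sub>v
    (Ub *\<^sub>v vec p (\<lambda>t. if t < d then z $ t / s (t + 1) else 0))" (is "_ = _ *\<^sub>v (Ub *\<^sub>v ?w)")
proof (rule eq_vecI)
  fix i assume "i < dim_vec (transpose_mat S *\<^sub>v (Ub *\<^sub>v ?w))"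
  then have i: "i < N" using S by simp
  have "(transpose_mat S *\<^sub>v (Ub *\<^sub>v ?w)) $ i = ((transpose_mat S * Ub) *\<^sub>v ?w) $ i"
    using assoc_mult_mat_vec[of "transpose_mat S" N p Ub p ?w] S W.U by simp
  also have "\<dots> = (\<Sum>t<p. (transpose_mat S *\<^sub>v col Ub t) $ i * (if t < d then z $ t / s (t + 1) else 0))"
    using S W.U i
    by (simp add: scalar_prod_def[of _ ?w] atLeast0LessThan del: assoc_mult_mat_vec)
  also have "\<dots> = (\<Sum>t<d. (transpose_mat S *\<^sub>v col Ub t) $ i * (z $ t / s (t + 1)))"
    using assms by (intro sum.mono_neutral_cong_right) auto
  also have "\<dots> = (\<Sum>t<d. ritz t $ i * z $ t)"
    using i S by (intro sum.cong) (auto simp: ritz_def)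
  also have "\<dots> = (ritz_mat d *\<^sub>v z) $ i"
    using i assms by (simp add: ritz_mat_def scalar_prod_def atLeast0LessThan)
  finally show "(ritz_mat d *\<^sub>v z) $ i = (transpose_mat S *\<^sub>v (Ub *\<^sub>v ?w)) $ i" ..
qed (use S in \<open>simp add: ritz_mat_def\<close>)

text \<open>With \<open>W^T\<close> in place of \<open>S^T\<close> the map would be an exact
  isometry, as the factors \<open>1 / s (t + 1)\<close> cancel the singular values. The exchange
  costs \<kappa> times the squared norm of the rescaled coefficients, which is at most that of
  \<open>z\<close> divided by \<gamma>.\<close>

lemma ritz_mat_norm:
  assumes d: "d \<le> p" and z: "z \<in> carrier_vec d" and \<gamma>: "0 < \<gamma>" "\<And>t. t \<in> {1..d} \<Longrightarrow> \<gamma> \<le> (s t)\<^sup>2"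
  shows "\<bar>(vec_norm2 (ritz_mat d *\<^sub>v z))\<^sup>2 - (vec_norm2 z)\<^sup>2\<bar> \<le> \<kappa> / \<gamma> * (vec_norm2 z)\<^sup>2"
proof -
  define w where "w = vec p (\<lambda>t. if t < d then z $ t / s (t + 1) else 0)"
  have w: "w \<in> carrier_vec p" by (simp add: w_def)
  have Uw: "Ub *\<^sub>v w \<in> carrier_vec p" using W.U w by simp
  have spos: "\<gamma> \<le> (s (t + 1))\<^sup>2" if "t < d" for t using \<gamma>(2)[of "t + 1"] that by simp
  have "transpose_mat Ub *\<^sub>v (Ub *\<^sub>v w) = w"
    using assoc_mult_mat_vec[of "transpose_mat Ub" p p Ub p w] W.U w W.UTU by simp
  then have "(vec_norm2 (transpose_mat W *\<^sub>v (Ub *\<^sub>v w)))\<^sup>2 = (\<Sum>t<p. (s (t + 1))\<^sup>2 * (w $ t)\<^sup>2)"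
    using Wt.norm_M_sq[OF Uw] by simp
  also have "\<dots> = (\<Sum>t<d. (s (t + 1))\<^sup>2 * (z $ t / s (t + 1))\<^sup>2)"
    using d by (intro sum.mono_neutral_cong_right) (auto simp: w_def)
  also have "\<dots> = (\<Sum>t<d. (z $ t)\<^sup>2)"
  proof (rule sum.cong)
    fix t assume "t \<in> {..<d}"
    then have "s (t + 1) \<noteq> 0" using spos[of t] \<gamma>(1) by auto
    then show "(s (t + 1))\<^sup>2 * (z $ t / s (t + 1))\<^sup>2 = (z $ t)\<^sup>2"
      by (simp add: power_divide)
  qed simp
  also have "\<dots> = (vec_norm2 z)\<^sup>2" using z by (simp add: vec_norm2_sq)
  finally have W: "(vec_norm2 (transpose_mat W *\<^sub>v (Ub *\<^sub>v w)))\<^sup>2 = (vec_norm2 z)\<^sup>2" .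
  have "(vec_norm2 (Ub *\<^sub>v w))\<^sup>2 = (vec_norm2 w)\<^sup>2"
    using vec_norm2_isometry[OF W.U W.UTU w] by simp
  also have "\<dots> = (\<Sum>t<d. (z $ t / s (t + 1))\<^sup>2)"
    unfolding vec_norm2_sq using d by (intro sum.mono_neutral_cong_right) (auto simp: w_def)
  also have "\<dots> \<le> (\<Sum>t<d. (z $ t)\<^sup>2 / \<gamma>)"
    using spos \<gamma>(1) by (intro sum_mono) (auto simp: power_divide intro!: frac_le)
  also have "\<dots> = (vec_norm2 z)\<^sup>2 / \<gamma>"
    using z by (simp add: vec_norm2_sq sum_divide_distrib)
  finally have "\<kappa> * (vec_norm2 (Ub *\<^sub>v w))\<^sup>2 \<le> \<kappa> * ((vec_norm2 z)\<^sup>2 / \<gamma>)"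
    using \<kappa>_nonneg by (intro mult_left_mono)
  then show ?thesis
    using col_gram[OF Uw] W ritz_mat_mult_vec[OF d z] by (simp add: w_def)
qed

lemma ritz_norm:
  assumes t: "t < p" and \<gamma>: "0 < \<gamma>" "\<gamma> \<le> (s (t + 1))\<^sup>2"
  shows "(vec_norm2 (ritz t))\<^sup>2 \<le> 1 + \<kappa> / \<gamma>"
proof -
  have "ritz_mat (t + 1) *\<^sub>v unit_vec (t + 1) t = col (ritz_mat (t + 1)) t"
    using ritz_mat_carrier[of "t + 1"] by (intro eq_vecI) auto
  then have "ritz t = ritz_mat (t + 1) *\<^sub>v unit_vec (t + 1) t"
    by (simp add: col_ritz_mat)
  moreover have "(vec_norm2 (unit_vec (t + 1) t))\<^sup>2 = 1"
    by (simp add: vec_norm2_sq_scalar)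
  moreover have "\<gamma> \<le> (s i)\<^sup>2" if "i \<in> {1..t + 1}" for i
    using W.s_sq_antimono[of i "t + 1"] that t \<gamma> by auto
  ultimately show ?thesis
    using ritz_mat_norm[of "t + 1" "unit_vec (t + 1) t" \<gamma>] t \<gamma>(1) by auto
qed

text \<open>The defect of \<open>ritz t\<close> in the eigenvector equation of \<open>C^T C\<close>:
  the first summand comes from the row sketch, the second from the column sketch, carried over by
  \<open>S^T\<close>.\<close>

definition residual :: "nat \<Rightarrow> real vec" where
  "residual t = (transpose_mat C * C - transpose_mat S * S) *\<^sub>v ritz t
    + (1 / s (t + 1)) \<cdot>\<^sub>v (transpose_mat S *\<^sub>v ((S * transpose_mat S - W * transpose_mat W) *\<^sub>v col Ub t))"

text \<open>The first summand contributes \<open>2 * \<kappa>\<close>, since a Ritz vector has norm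
  at most 2. In the second, \<open>S^T\<close> costs at most \<open>f\<close>, and the division by
  the singular value at most \<open>1 / sqrt \<gamma>\<close>.\<close>

lemma residual_norm:
  assumes t: "t < p" and \<gamma>: "0 < \<gamma>" "\<gamma> \<le> (s (t + 1))\<^sup>2" and \<kappa>\<gamma>: "\<kappa> \<le> \<gamma>"
  shows "vec_norm2 (residual t) \<le> \<kappa> * (2 + f / sqrt \<gamma>)"
proof -
  let ?E = "transpose_mat C * C - transpose_mat S * S"
  let ?D = "S * transpose_mat S - W * transpose_mat W"
  have E: "?E \<in> carrier_mat N N" using S by (intro minus_carrier_mat) auto
  have D: "?D \<in> carrier_mat p p" using W.M by (intro minus_carrier_mat) auto
  have col: "col Ub t \<in> carrier_vec p" using W.U by (auto intro: carrier_vecI)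
  have f0: "0 \<le> f" using frob_S frob_norm_nonneg order_trans by blast
  have st: "sqrt \<gamma> \<le> s (t + 1)" using \<gamma> t W.s_nonneg[of "t + 1"] by (intro real_le_lsqrt) auto
  have "col Ub t = Ub *\<^sub>v unit_vec p t"
    using W.U t by (intro eq_vecI) auto
  moreover have "vec_norm2 (unit_vec p t) = 1"
    by (rule power2_eq_imp_eq) (use t in \<open>auto simp: vec_norm2_sq_scalar\<close>)
  ultimately have n1: "vec_norm2 (col Ub t) = 1"
    using vec_norm2_isometry[OF W.U W.UTU, of "unit_vec p t"] by simp
  have "\<kappa> / \<gamma> \<le> 1" using \<kappa>\<gamma> \<gamma>(1) by simp
  then have "(vec_norm2 (ritz t))\<^sup>2 \<le> 4"
    using ritz_norm[OF t \<gamma>] by linarith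
  then have "(vec_norm2 (ritz t))\<^sup>2 \<le> 2\<^sup>2" by simp
  then have n2: "vec_norm2 (ritz t) \<le> 2" by (rule power2_le_imp_le) simp
  have "vec_norm2 (?E *\<^sub>v ritz t) \<le> frob_norm ?E * vec_norm2 (ritz t)"
    using E ritz_carrier by (rule vec_norm2_mult_mat_le)
  also have "\<dots> \<le> \<kappa> * 2" using row_error n2 \<kappa>_nonneg by (intro mult_mono) auto
  finally have b1: "vec_norm2 (?E *\<^sub>v ritz t) \<le> \<kappa> * 2" .
  have "vec_norm2 (?D *\<^sub>v col Ub t) \<le> frob_norm ?D * vec_norm2 (col Ub t)"
    using D col by (rule vec_norm2_mult_mat_le)
  also have "\<dots> \<le> \<kappa>" using col_error n1 by simp
  finally have bD: "vec_norm2 (?D *\<^sub>v col Ub t) \<le> \<kappa>" .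
  have "vec_norm2 (transpose_mat S *\<^sub>v (?D *\<^sub>v col Ub t))
      \<le> frob_norm (transpose_mat S) * vec_norm2 (?D *\<^sub>v col Ub t)"
    using S D col by (intro vec_norm2_mult_mat_le[of _ N p]) auto
  also have "\<dots> \<le> f * \<kappa>"
    using bD frob_S f0 by (intro mult_mono) (auto simp: frob_norm_transpose)
  finally have b2: "vec_norm2 (transpose_mat S *\<^sub>v (?D *\<^sub>v col Ub t)) \<le> f * \<kappa>" .
  have "vec_norm2 (residual t) \<le> vec_norm2 (?E *\<^sub>v ritz t)
      + vec_norm2 ((1 / s (t + 1)) \<cdot>\<^sub>v (transpose_mat S *\<^sub>v (?D *\<^sub>v col Ub t)))"
    unfolding residual_def using E S by (intro vec_norm2_add_le) auto
  also have "\<dots> \<le> \<kappa> * 2 + (1 / sqrt \<gamma>) * (f * \<kappa>)"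
  proof -
    have "0 < sqrt \<gamma>" using \<gamma>(1) by simp
    moreover from this have "0 < s (t + 1)" using st by linarith
    ultimately have "\<bar>1 / s (t + 1)\<bar> = 1 / s (t + 1)" and "1 / s (t + 1) \<le> 1 / sqrt \<gamma>"
      using st by (auto intro!: divide_left_mono)
    then show ?thesis
      unfolding vec_norm2_smult using \<gamma>(1) b2 b1 f0 \<kappa>_nonneg by (intro add_mono mult_mono) auto
  qed
  finally show ?thesis by (simp add: algebra_simps)
qed

text \<open>Move \<open>S\<close> past its transpose: \<open>S^T S\<close> applied to
  \<open>S^T u\<close> is \<open>S^T\<close> applied to \<open>S S^T u\<close>, and \<open>u\<close>
  is an exact eigenvector of \<open>W W^T\<close>. The two replacements of Gram matrices form the
  residual.\<close>

lemma gram_ritz: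
  assumes t: "t < p" and s0: "s (t + 1) \<noteq> 0"
  shows "transpose_mat C * C *\<^sub>v ritz t = (s (t + 1))\<^sup>2 \<cdot>\<^sub>v ritz t + residual t"
proof -
  let ?G = "transpose_mat C * C" and ?H = "transpose_mat S * S"
  let ?K = "S * transpose_mat S" and ?L = "W * transpose_mat W"
  let ?u = "col Ub t" and ?c = "s (t + 1)"
  have G: "?G \<in> carrier_mat N N" and H: "?H \<in> carrier_mat N N"
    and K: "?K \<in> carrier_mat p p" and L: "?L \<in> carrier_mat p p"
    using C.M S W.M by auto
  have St: "transpose_mat S \<in> carrier_mat N p" and u: "?u \<in> carrier_vec p"
    using S W.U by (auto intro: carrier_vecI)
  have Lu: "?L *\<^sub>v ?u = ?c\<^sup>2 \<cdot>\<^sub>v ?u"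
  proof -
    have "?L *\<^sub>v ?u = W *\<^sub>v (?c \<cdot>\<^sub>v col Vb t)"
      using assoc_mult_mat_vec[of W p p "transpose_mat W" p ?u] W.M u Wt.M_col_V[of t] t by simp
    also have "\<dots> = ?c \<cdot>\<^sub>v (W *\<^sub>v col Vb t)"
      using W.M W.V by (intro mult_mat_vec[of _ p p]) (auto intro: carrier_vecI)
    finally show ?thesis using W.M_col_V[of t] t by (simp add: smult_smult_assoc power2_eq_square)
  qed
  have "?H *\<^sub>v ritz t = (1 / ?c) \<cdot>\<^sub>v (transpose_mat S *\<^sub>v (?K *\<^sub>v ?u))"
  proof -
    have "?H *\<^sub>v ritz t = transpose_mat S *\<^sub>v (S *\<^sub>v ritz t)"
      using S ritz_carrier by (intro assoc_mult_mat_vec) auto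
    also have "S *\<^sub>v ritz t = (1 / ?c) \<cdot>\<^sub>v (S *\<^sub>v (transpose_mat S *\<^sub>v ?u))"
      unfolding ritz_def using S St u by (intro mult_mat_vec[of _ p N]) auto
    also have "S *\<^sub>v (transpose_mat S *\<^sub>v ?u) = ?K *\<^sub>v ?u"
      using S St u by (intro assoc_mult_mat_vec[symmetric]) auto
    also have "transpose_mat S *\<^sub>v ((1 / ?c) \<cdot>\<^sub>v (?K *\<^sub>v ?u)) = (1 / ?c) \<cdot>\<^sub>v (transpose_mat S *\<^sub>v (?K *\<^sub>v ?u))"
      using K St u by (intro mult_mat_vec[of _ N p]) auto
    finally show ?thesis .
  qed
  also have "?K *\<^sub>v ?u = ?c\<^sup>2 \<cdot>\<^sub>v ?u + (?K - ?L) *\<^sub>v ?u"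
  proof -
    have "(?K - ?L) *\<^sub>v ?u = ?K *\<^sub>v ?u - ?c\<^sup>2 \<cdot>\<^sub>v ?u"
      using minus_mult_distrib_mat_vec[OF K L u] Lu by simp
    then show ?thesis using S W.U by (intro eq_vecI) auto
  qed
  also have "transpose_mat S *\<^sub>v \<dots> = ?c\<^sup>2 \<cdot>\<^sub>v (transpose_mat S *\<^sub>v ?u) + transpose_mat S *\<^sub>v ((?K - ?L) *\<^sub>v ?u)"
    using St u minus_carrier_mat[OF L, of ?K]
    by (simp add: mult_add_distrib_mat_vec[of _ N p] mult_mat_vec[of _ N p])
  finally have Hr: "?H *\<^sub>v ritz t = (1 / ?c) \<cdot>\<^sub>v (?c\<^sup>2 \<cdot>\<^sub>v (transpose_mat S *\<^sub>v ?u)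
    + transpose_mat S *\<^sub>v ((?K - ?L) *\<^sub>v ?u))" .
  have Gr: "(?G - ?H) *\<^sub>v ritz t = ?G *\<^sub>v ritz t - ?H *\<^sub>v ritz t"
    by (rule minus_mult_distrib_mat_vec[OF G H ritz_carrier])
  show ?thesis
  proof (rule eq_vecI)
    fix i assume "i < dim_vec (?c\<^sup>2 \<cdot>\<^sub>v ritz t + residual t)"
    then have i: "i < N" using S by (simp add: residual_def)
    show "(?G *\<^sub>v ritz t) $ i = (?c\<^sup>2 \<cdot>\<^sub>v ritz t + residual t) $ i"
      using i S s0 G H St ritz_carrier[of t] unfolding residual_def Gr Hr
      by (simp add: ritz_def algebra_simps del: index_mult_mat_vec)
  qed (use C.M S in \<open>simp add: residual_def\<close>)
qed

text \<open>Pairing the perturbed equation \<open>gram_ritz\<close> with an exact eigenvector of the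
  symmetric matrix \<open>C^T C\<close> decouples it into scalar equations.\<close>

lemma V_residual:
  assumes t: "t < p" and s0: "s (t + 1) \<noteq> 0" and j: "j < N"
  shows "(transpose_mat V *\<^sub>v residual t) $ j
    = ((\<sigma> (j + 1))\<^sup>2 - (s (t + 1))\<^sup>2) * (transpose_mat V *\<^sub>v ritz t) $ j"
proof -
  let ?v = "col V j"
  have v: "?v \<in> carrier_vec N" using C.V by (auto intro: carrier_vecI)
  have CtC: "transpose_mat C * C \<in> carrier_mat N N" using C.M by auto
  interpret Ct: svd_decomposition "transpose_mat C" V U \<sigma> N m
    using C.M is_svd_transpose[OF C.svd] by unfold_locales auto
  have res: "residual t \<in> carrier_vec N"
    using S by (auto simp: residual_def intro!: carrier_vecI)
  have "transpose_mat C * C *\<^sub>v ?v = transpose_mat C *\<^sub>v (C *\<^sub>v ?v)"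
    using C.M v by (intro assoc_mult_mat_vec) auto
  also have "\<dots> = \<sigma> (j + 1) \<cdot>\<^sub>v (transpose_mat C *\<^sub>v col U j)"
    using C.M_col_V[of j] j N_le C.M C.U
    by (simp add: mult_mat_vec[of _ N m] carrier_vecI)
  also have "\<dots> = (\<sigma> (j + 1))\<^sup>2 \<cdot>\<^sub>v ?v"
    using Ct.M_col_V[of j] j N_le by (simp add: smult_smult_assoc power2_eq_square)
  finally have eig: "transpose_mat C * C *\<^sub>v ?v = (\<sigma> (j + 1))\<^sup>2 \<cdot>\<^sub>v ?v" .
  have sym: "transpose_mat (transpose_mat C * C) = transpose_mat C * C"
    using C.M by (simp add: transpose_mult[of _ N m _ N])
  have "(\<sigma> (j + 1))\<^sup>2 * (?v \<bullet> ritz t) = (transpose_mat C * C *\<^sub>v ?v) \<bullet> ritz t"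
    using eig v ritz_carrier[of t] by simp
  also have "\<dots> = ?v \<bullet> (transpose_mat C * C *\<^sub>v ritz t)"
    using scalar_prod_mult_mat_vec[OF CtC v ritz_carrier] sym by simp
  also have "\<dots> = (s (t + 1))\<^sup>2 * (?v \<bullet> ritz t) + ?v \<bullet> residual t"
    using v ritz_carrier[of t] res gram_ritz[OF t s0] by (simp add: scalar_prod_add_distrib[of _ N])
  finally have "?v \<bullet> residual t = ((\<sigma> (j + 1))\<^sup>2 - (s (t + 1))\<^sup>2) * (?v \<bullet> ritz t)"
    by (simp add: algebra_simps)
  then show ?thesis using j C.V by simp
qed

text \<open>
  The leakage into the trailing singular vectors solves a diagonal Sylvester equation whose
  coefficients are bounded below by the gap \<open>\<gamma>\<close>.
\<close>

lemma ritz_leakage: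
  assumes t: "t < p" and \<gamma>: "0 < \<gamma>" "\<gamma> \<le> (s (t + 1))\<^sup>2" and \<kappa>\<gamma>: "\<kappa> \<le> \<gamma>"
    and gap: "\<And>j. j \<in> {d..<N} \<Longrightarrow> \<gamma> \<le> (s (t + 1))\<^sup>2 - (\<sigma> (j + 1))\<^sup>2"
  shows "(\<Sum>j\<in>{d..<N}. ((transpose_mat V *\<^sub>v ritz t) $ j)\<^sup>2) \<le> (\<kappa> * (2 + f / sqrt \<gamma>) / \<gamma>)\<^sup>2"
proof -
  have s0: "s (t + 1) \<noteq> 0" using \<gamma> by auto
  have res: "residual t \<in> carrier_vec N"
    using S by (auto simp: residual_def intro!: carrier_vecI)
  have "\<gamma>\<^sup>2 * (\<Sum>j\<in>{d..<N}. ((transpose_mat V *\<^sub>v ritz t) $ j)\<^sup>2)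
      \<le> (\<Sum>j\<in>{d..<N}. ((transpose_mat V *\<^sub>v residual t) $ j)\<^sup>2)"
    unfolding sum_distrib_left
  proof (rule sum_mono)
    fix j assume j: "j \<in> {d..<N}"
    have "\<gamma>\<^sup>2 \<le> ((s (t + 1))\<^sup>2 - (\<sigma> (j + 1))\<^sup>2)\<^sup>2"
      using gap[OF j] \<gamma> by (intro power_mono) auto
    also have "\<dots> = ((\<sigma> (j + 1))\<^sup>2 - (s (t + 1))\<^sup>2)\<^sup>2" by (rule power2_commute)
    finally have "\<gamma>\<^sup>2 * ((transpose_mat V *\<^sub>v ritz t) $ j)\<^sup>2
        \<le> ((\<sigma> (j + 1))\<^sup>2 - (s (t + 1))\<^sup>2)\<^sup>2 * ((transpose_mat V *\<^sub>v ritz t) $ j)\<^sup>2"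
      by (intro mult_right_mono) auto
    then show "\<gamma>\<^sup>2 * ((transpose_mat V *\<^sub>v ritz t) $ j)\<^sup>2 \<le> ((transpose_mat V *\<^sub>v residual t) $ j)\<^sup>2"
      using V_residual[OF t s0, of j] j by (simp add: power_mult_distrib del: index_mult_mat_vec)
  qed
  also have "\<dots> \<le> (\<Sum>j<N. ((transpose_mat V *\<^sub>v residual t) $ j)\<^sup>2)"
    by (intro sum_mono2) auto
  also have "\<dots> = (vec_norm2 (transpose_mat V *\<^sub>v residual t))\<^sup>2"
    using C.V by (simp add: vec_norm2_sq)
  also have "\<dots> = (vec_norm2 (residual t))\<^sup>2" using C.norm_VT[OF res] by simp
  also have "\<dots> \<le> (\<kappa> * (2 + f / sqrt \<gamma>))\<^sup>2"
    using residual_norm[OF t \<gamma> \<kappa>\<gamma>] by (intro power_mono) auto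
  finally show ?thesis using \<gamma>(1) by (simp add: power_divide field_simps)
qed

text \<open>Cauchy-Schwarz over the coefficients of \<open>z\<close> combines the leakages of the
  \<open>d\<close> single Ritz vectors, whence the factor \<open>d\<close>.\<close>

lemma ritz_mat_leakage:
  assumes d: "d \<le> p" and z: "z \<in> carrier_vec d"
    and \<gamma>: "0 < \<gamma>" "\<And>t. t \<in> {1..d} \<Longrightarrow> \<gamma> \<le> (s t)\<^sup>2" and \<kappa>\<gamma>: "\<kappa> \<le> \<gamma>"
    and gap: "\<And>t j. t \<in> {1..d} \<Longrightarrow> j \<in> {d..<N} \<Longrightarrow> \<gamma> \<le> (s t)\<^sup>2 - (\<sigma> (j + 1))\<^sup>2"
  shows "(\<Sum>j\<in>{d..<N}. ((transpose_mat V *\<^sub>v (ritz_mat d *\<^sub>v z)) $ j)\<^sup>2)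
    \<le> real d * (\<kappa> * (2 + f / sqrt \<gamma>) / \<gamma>)\<^sup>2 * (vec_norm2 z)\<^sup>2"
proof -
  let ?x = "\<lambda>j t. (transpose_mat V *\<^sub>v ritz t) $ j"
  have "((transpose_mat V *\<^sub>v (ritz_mat d *\<^sub>v z)) $ j)\<^sup>2 \<le> (\<Sum>t<d. (?x j t)\<^sup>2) * (vec_norm2 z)\<^sup>2"
    if j: "j < N" for j
  proof -
    have "transpose_mat V *\<^sub>v (ritz_mat d *\<^sub>v z) = (transpose_mat V * ritz_mat d) *\<^sub>v z"
      using C.V ritz_mat_carrier z by (intro assoc_mult_mat_vec[symmetric]) auto
    then have "(transpose_mat V *\<^sub>v (ritz_mat d *\<^sub>v z)) $ j = row (transpose_mat V * ritz_mat d) j \<bullet> z"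
      using j C.V by simp
    also have "row (transpose_mat V * ritz_mat d) j = vec d (?x j)"
      using j C.V ritz_mat_carrier[of d] by (intro eq_vecI) (auto simp: col_ritz_mat)
    finally have "\<bar>(transpose_mat V *\<^sub>v (ritz_mat d *\<^sub>v z)) $ j\<bar> \<le> vec_norm2 (vec d (?x j)) * vec_norm2 z"
      using scalar_prod_le_norms[of "vec d (?x j)" z] z by auto
    then have "\<bar>(transpose_mat V *\<^sub>v (ritz_mat d *\<^sub>v z)) $ j\<bar>\<^sup>2 \<le> (vec_norm2 (vec d (?x j)) * vec_norm2 z)\<^sup>2"
      by (intro power_mono) auto
    then show ?thesis by (simp add: power_mult_distrib vec_norm2_sq del: index_mult_mat_vec)
  qed
  then have "(\<Sum>j\<in>{d..<N}. ((transpose_mat V *\<^sub>v (ritz_mat d *\<^sub>v z)) $ j)\<^sup>2)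
      \<le> (\<Sum>j\<in>{d..<N}. (\<Sum>t<d. (?x j t)\<^sup>2) * (vec_norm2 z)\<^sup>2)"
    by (intro sum_mono) auto
  also have "\<dots> = (\<Sum>t<d. \<Sum>j\<in>{d..<N}. (?x j t)\<^sup>2) * (vec_norm2 z)\<^sup>2"
    unfolding sum_distrib_right[symmetric] by (subst sum.swap) (rule refl)
  also have "\<dots> \<le> (\<Sum>t<d. (\<kappa> * (2 + f / sqrt \<gamma>) / \<gamma>)\<^sup>2) * (vec_norm2 z)\<^sup>2"
  proof (intro mult_right_mono sum_mono)
    fix t assume "t \<in> {..<d}"
    then show "(\<Sum>j\<in>{d..<N}. (?x j t)\<^sup>2) \<le> (\<kappa> * (2 + f / sqrt \<gamma>) / \<gamma>)\<^sup>2"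
      using d \<gamma> \<kappa>\<gamma> gap by (intro ritz_leakage) auto
  qed simp
  finally show ?thesis by simp
qed

end

section \<open>Truncated total least squares\<close>

text \<open>The lower bound makes \<open>G = B B^T\<close> invertible, and \<open>B^T\<close> times
  the inverse of \<open>G\<close> satisfies the four Penrose equations. So the pseudoinverse is a
  right inverse of \<open>B\<close> and its values lie in the range of \<open>B^T\<close>.\<close>

lemma pinv_full_row_rank:
  assumes B: "B \<in> carrier_mat d n" and \<beta>: "\<beta> \<in> carrier_vec d" and \<mu>: "0 < \<mu>"
    and lower: "\<And>z. z \<in> carrier_vec d \<Longrightarrow> \<mu> * vec_norm2 z \<le> vec_norm2 (transpose_mat B *\<^sub>v z)"
  shows "pinv B *\<^sub>v \<beta> \<in> carrier_vec n"
    and "B *\<^sub>v (pinv B *\<^sub>v \<beta>) = \<beta>"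
    and "vec_norm2 (pinv B *\<^sub>v \<beta>) \<le> vec_norm2 \<beta> / \<mu>"
proof -
  let ?Bt = "transpose_mat B"
  define G where "G = B * ?Bt"
  have Bt: "?Bt \<in> carrier_mat n d" and G: "G \<in> carrier_mat d d" using B by (auto simp: G_def)
  have "Determinant.det G \<noteq> 0"
  proof
    assume "Determinant.det G = 0"
    then obtain z where z: "z \<in> carrier_vec d" "z \<noteq> 0\<^sub>v d" "G *\<^sub>v z = 0\<^sub>v d"
      using det_0_iff_vec_prod_zero[OF G] by auto
    have "(vec_norm2 (?Bt *\<^sub>v z))\<^sup>2 = z \<bullet> (G *\<^sub>v z)"
      using vec_norm2_mult_mat_sq[OF Bt z(1)] by (simp add: G_def)
    then have "vec_norm2 (?Bt *\<^sub>v z) = 0" using z by simp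
    then show False
      using lower[OF z(1)] vec_norm2_pos[OF z(1,2)] mult_pos_pos[OF \<mu>, of "vec_norm2 z"] by simp
  qed
  then obtain H where H: "H \<in> carrier_mat d d" "G * H = 1\<^sub>m d" "H * G = 1\<^sub>m d"
    using det_non_zero_imp_unit[OF G] by (auto simp: Units_def ring_mat_def)
  have Gt: "transpose_mat G = G"
    using B by (simp add: G_def transpose_mult[OF B Bt])
  have Ht: "transpose_mat H = H"
  proof -
    have "transpose_mat H * G = 1\<^sub>m d"
      using transpose_mult[OF G H(1)] H(2) Gt by simp
    then have "transpose_mat H = transpose_mat H * (G * H)" using H by simp
    also have "\<dots> = (transpose_mat H * G) * H"
      using G H(1) by (intro assoc_mult_mat[symmetric]) auto
    finally show ?thesis using H \<open>transpose_mat H * G = 1\<^sub>m d\<close> by simp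
  qed
  define X where "X = ?Bt * H"
  have X: "X \<in> carrier_mat n d" using Bt H by (simp add: X_def)
  have BX: "B * X = 1\<^sub>m d"
    using assoc_mult_mat[OF B Bt H(1)] H(2) by (simp add: X_def G_def)
  have XB: "transpose_mat (X * B) = X * B"
    using transpose_mult[OF X B] transpose_mult[OF Bt H(1)] assoc_mult_mat[OF Bt H(1) B] Ht
    by (simp add: X_def)
  have "is_pinv B X"
    unfolding is_pinv_def
    using X B BX XB assoc_mult_mat[OF X B X] by auto
  then have x: "pinv B *\<^sub>v \<beta> = ?Bt *\<^sub>v (H *\<^sub>v \<beta>)"
    using pinv_eqI[of B X] assoc_mult_mat_vec[OF Bt H(1) \<beta>] by (simp add: X_def)
  have g: "H *\<^sub>v \<beta> \<in> carrier_vec d" using H \<beta> by simp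
  show xc: "pinv B *\<^sub>v \<beta> \<in> carrier_vec n" using x Bt g by simp
  show Bx: "B *\<^sub>v (pinv B *\<^sub>v \<beta>) = \<beta>"
    using x assoc_mult_mat_vec[OF B Bt g] assoc_mult_mat_vec[OF G H(1) \<beta>] H(2) \<beta>
    by (simp add: G_def)
  \<comment> \<open>Write the solution as \<open>x = B^T g\<close> with
    \<open>g = H *\<^sub>v \<beta>\<close>. Its squared norm is the product of \<open>g\<close> with
    \<open>B x = \<beta>\<close>, and \<open>lower\<close> bounds \<open>g\<close> by
    \<open>x\<close>.\<close>
  have "(vec_norm2 (pinv B *\<^sub>v \<beta>))\<^sup>2 = (H *\<^sub>v \<beta>) \<bullet> \<beta>"
    using scalar_prod_mult_mat_vec[OF Bt g xc] x Bx by (simp add: vec_norm2_sq_scalar)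
  also have "\<dots> \<le> vec_norm2 (H *\<^sub>v \<beta>) * vec_norm2 \<beta>"
    using scalar_prod_le_norms[of "H *\<^sub>v \<beta>" \<beta>] H(1) \<beta> by auto
  also have "\<dots> \<le> (vec_norm2 (pinv B *\<^sub>v \<beta>) / \<mu>) * vec_norm2 \<beta>"
    using lower[OF g] x \<mu> by (intro mult_right_mono) (auto simp: field_simps)
  finally have "vec_norm2 (pinv B *\<^sub>v \<beta>) * vec_norm2 (pinv B *\<^sub>v \<beta>)
      \<le> vec_norm2 (pinv B *\<^sub>v \<beta>) * (vec_norm2 \<beta> / \<mu>)"
    by (simp add: power2_eq_square)
  then show "vec_norm2 (pinv B *\<^sub>v \<beta>) \<le> vec_norm2 \<beta> / \<mu>"
  proof (cases "0 < vec_norm2 (pinv B *\<^sub>v \<beta>)")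
    case False
    then have "vec_norm2 (pinv B *\<^sub>v \<beta>) = 0"
      using vec_norm2_nonneg[of "pinv B *\<^sub>v \<beta>"] by linarith
    then show ?thesis using \<mu> by simp
  qed (simp only: mult_le_cancel_left_pos)
qed

section \<open>Upper block and last row of the right singular vectors\<close>

definition head_vec :: "nat \<Rightarrow> real vec \<Rightarrow> real vec" where
  "head_vec n x = vec n (\<lambda>i. x $ i)"

lemma dim_head_vec [simp]: "dim_vec (head_vec n x) = n"
  by (simp add: head_vec_def)

lemma head_vec_norm_le: "n \<le> dim_vec x \<Longrightarrow> vec_norm2 (head_vec n x) \<le> vec_norm2 x"
  by (rule power2_le_imp_le) (auto simp: vec_norm2_sq head_vec_def intro!: sum_mono2)

lemma block11_carrier: "block11 n d M \<in> carrier_mat n d"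
  by (simp add: block11_def)

lemma block21_carrier: "block21 n d M \<in> carrier_vec d"
  by (simp add: block21_def)

text \<open>Because \<open>w\<close> vanishes from \<open>d\<close> on, the columns outside the
  blocks drop out, and block products can be read off from \<open>M *\<^sub>v w\<close>.\<close>

lemma block11_mult_vec:
  assumes "M \<in> carrier_mat (n + 1) l" "d \<le> l" "w \<in> carrier_vec l" "\<And>j. d \<le> j \<Longrightarrow> j < l \<Longrightarrow> w $ j = 0"
  shows "block11 n d M *\<^sub>v vec d (\<lambda>j. w $ j) = head_vec n (M *\<^sub>v w)"
    and "block21 n d M \<bullet> vec d (\<lambda>j. w $ j) = (M *\<^sub>v w) $ n"
proof -
  have row: "row M i \<bullet> w = (\<Sum>j<d. M $$ (i, j) * w $ j)" if "i < n + 1" for i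
  proof -
    have "row M i \<bullet> w = (\<Sum>j<l. M $$ (i, j) * w $ j)"
      using assms that by (simp add: scalar_prod_def atLeast0LessThan)
    also have "\<dots> = (\<Sum>j<d. M $$ (i, j) * w $ j)"
      using assms by (intro sum.mono_neutral_right) auto
    finally show ?thesis .
  qed
  show "block11 n d M *\<^sub>v vec d (\<lambda>j. w $ j) = head_vec n (M *\<^sub>v w)"
  proof (rule eq_vecI)
    fix i assume "i < dim_vec (head_vec n (M *\<^sub>v w))"
    then have i: "i < n" by simp
    have "(block11 n d M *\<^sub>v vec d (\<lambda>j. w $ j)) $ i = (\<Sum>j<d. M $$ (i, j) * w $ j)"
      using i by (simp add: block11_def scalar_prod_def atLeast0LessThan)
    then show "(block11 n d M *\<^sub>v vec d (\<lambda>j. w $ j)) $ i = head_vec n (M *\<^sub>v w) $ i"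
      using i assms(1) row[of i] by (simp add: head_vec_def)
  qed (simp add: block11_def)
  have "block21 n d M \<bullet> vec d (\<lambda>j. w $ j) = (\<Sum>j<d. M $$ (n, j) * w $ j)"
    by (simp add: block21_def scalar_prod_def atLeast0LessThan)
  then show "block21 n d M \<bullet> vec d (\<lambda>j. w $ j) = (M *\<^sub>v w) $ n"
    using assms(1) row[of n] by simp
qed

lemma block11_mult_vec_all:
  assumes "M \<in> carrier_mat (n + 1) d" "z \<in> carrier_vec d"
  shows "block11 n d M *\<^sub>v z = head_vec n (M *\<^sub>v z)"
    and "block21 n d M \<bullet> z = (M *\<^sub>v z) $ n"
proof -
  have "vec d (\<lambda>j. z $ j) = z" using assms by (intro eq_vecI) auto
  then show "block11 n d M *\<^sub>v z = head_vec n (M *\<^sub>v z)"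
    and "block21 n d M \<bullet> z = (M *\<^sub>v z) $ n"
    using block11_mult_vec[OF assms(1) order_refl assms(2)] by auto
qed

lemma index_le_vec_norm2:
  assumes "i < dim_vec v"
  shows "\<bar>v $ i\<bar> \<le> vec_norm2 v"
proof (rule power2_le_imp_le)
  have "(v $ i)\<^sup>2 \<le> (\<Sum>j<dim_vec v. (v $ j)\<^sup>2)"
    using assms by (intro member_le_sum) auto
  then show "\<bar>v $ i\<bar>\<^sup>2 \<le> (vec_norm2 v)\<^sup>2" by (simp add: vec_norm2_sq)
qed simp

text \<open>Pad \<open>z\<close> with zeros: \<open>V\<close> preserves the norm, and deleting the
  last coordinate can only shrink it.\<close>

lemma block11_isometry_norm_le:
  assumes V: "V \<in> carrier_mat (n + 1) (n + 1)" and VTV: "transpose_mat V * V = 1\<^sub>m (n + 1)"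
    and d: "d \<le> n + 1" and z: "z \<in> carrier_vec d"
  shows "vec_norm2 (block11 n d V *\<^sub>v z) \<le> vec_norm2 z"
proof -
  define w where "w = vec (n + 1) (\<lambda>j. if j < d then z $ j else 0)"
  have w: "w \<in> carrier_vec (n + 1)" by (simp add: w_def)
  have "vec d (\<lambda>j. w $ j) = z"
    using d z by (intro eq_vecI) (auto simp: w_def)
  then have "block11 n d V *\<^sub>v z = head_vec n (V *\<^sub>v w)"
    using block11_mult_vec(1)[OF V d w] by (simp add: w_def)
  then have "vec_norm2 (block11 n d V *\<^sub>v z) \<le> vec_norm2 (V *\<^sub>v w)"
    using head_vec_norm_le[of n "V *\<^sub>v w"] V by simp
  also have "\<dots> = vec_norm2 w" by (rule vec_norm2_isometry[OF V VTV w])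
  also have "\<dots> = vec_norm2 z"
  proof (rule power2_eq_imp_eq)
    have "(\<Sum>j<n + 1. (w $ j)\<^sup>2) = (\<Sum>j<d. (z $ j)\<^sup>2)"
      using d by (intro sum.mono_neutral_cong_right) (auto simp: w_def)
    then show "(vec_norm2 w)\<^sup>2 = (vec_norm2 z)\<^sup>2"
      using w z by (simp add: vec_norm2_sq)
  qed simp_all
  finally show ?thesis .
qed

text \<open>
  Only the distance of \<open>y\<close> to the span of the first \<open>d\<close> columns of \<open>V\<close> matters, so individual
  singular vectors need not be aligned.
\<close>

lemma head_vec_lower_bound:
  assumes V: "V \<in> carrier_mat (n + 1) (n + 1)" and VTV: "transpose_mat V * V = 1\<^sub>m (n + 1)"
    and d: "d \<le> n + 1" and \<tau>: "0 \<le> \<tau>" "\<tau> \<le> 1"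
    and lower: "\<And>w. w \<in> carrier_vec d \<Longrightarrow> \<tau> * vec_norm2 w \<le> vec_norm2 (block11 n d V *\<^sub>v w)"
    and y: "y \<in> carrier_vec (n + 1)" and \<rho>: "0 \<le> \<rho>"
    and leak: "(\<Sum>j\<in>{d..<n + 1}. ((transpose_mat V *\<^sub>v y) $ j)\<^sup>2) \<le> \<rho>\<^sup>2"
  shows "\<tau> * vec_norm2 y - 2 * \<rho> \<le> vec_norm2 (head_vec n y)"
proof -
  let ?c = "transpose_mat V *\<^sub>v y"
  \<comment> \<open>\<open>V *\<^sub>v w\<close> is the component of \<open>y\<close> in the span of
    the first \<open>d\<close> columns of \<open>V\<close>, and \<open>V *\<^sub>v w'\<close> is the
    leakage, of norm at most \<rho>.\<close>
  define w where "w = vec (n + 1) (\<lambda>j. if j < d then ?c $ j else 0)"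
  define w' where "w' = vec (n + 1) (\<lambda>j. if j < d then 0 else ?c $ j)"
  have w: "w \<in> carrier_vec (n + 1)" and w': "w' \<in> carrier_vec (n + 1)" by (auto simp: w_def w'_def)
  have c: "?c \<in> carrier_vec (n + 1)" using V y by auto
  have "?c = w + w'" using c V by (intro eq_vecI) (auto simp: w_def w'_def simp del: index_mult_mat_vec)
  moreover have "V *\<^sub>v ?c = y"
    using assoc_mult_mat_vec[of V "n + 1" "n + 1" "transpose_mat V" "n + 1" y] V y
      orthogonal_mult_transpose[OF V VTV] by simp
  ultimately have yw: "y = V *\<^sub>v w + V *\<^sub>v w'"
    using mult_add_distrib_mat_vec[OF V w w'] by simp
  have Vw': "vec_norm2 (V *\<^sub>v w') \<le> \<rho>"
  proof (rule power2_le_imp_le)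
    have "(vec_norm2 (V *\<^sub>v w'))\<^sup>2 = (\<Sum>j<n + 1. (w' $ j)\<^sup>2)"
      using vec_norm2_isometry[OF V VTV w'] w' by (simp add: vec_norm2_sq)
    also have "\<dots> = (\<Sum>j\<in>{d..<n + 1}. (?c $ j)\<^sup>2)"
      by (intro sum.mono_neutral_cong_right) (auto simp: w'_def simp del: index_mult_mat_vec)
    finally show "(vec_norm2 (V *\<^sub>v w'))\<^sup>2 \<le> \<rho>\<^sup>2" using leak by simp
  qed (rule \<rho>)
  let ?v = "vec d (\<lambda>j. w $ j)"
  have "(\<Sum>j<n + 1. (w $ j)\<^sup>2) = (\<Sum>j<d. (w $ j)\<^sup>2)"
    using d by (intro sum.mono_neutral_right) (auto simp: w_def)
  then have "(vec_norm2 ?v)\<^sup>2 = (vec_norm2 w)\<^sup>2"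
    using w by (simp add: vec_norm2_sq)
  then have nv: "vec_norm2 ?v = vec_norm2 w" by (rule power2_eq_imp_eq) simp_all
  have "vec_norm2 y \<le> vec_norm2 (V *\<^sub>v w) + vec_norm2 (V *\<^sub>v w')"
    unfolding yw using V by (intro vec_norm2_add_le) auto
  then have ny: "vec_norm2 y - \<rho> \<le> vec_norm2 w"
    using vec_norm2_isometry[OF V VTV w] Vw' by simp
  have "\<tau> * vec_norm2 w \<le> vec_norm2 (head_vec n (V *\<^sub>v w))"
    using lower[of ?v] nv block11_mult_vec(1)[OF V d w] by (simp add: w_def)
  also have "head_vec n (V *\<^sub>v w) = head_vec n y - head_vec n (V *\<^sub>v w')"
    using V y by (intro eq_vecI) (auto simp: head_vec_def yw simp del: index_mult_mat_vec)
  also have "vec_norm2 \<dots> \<le> vec_norm2 (head_vec n y) + vec_norm2 (head_vec n (V *\<^sub>v w'))"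
    by (intro vec_norm2_diff_le[of _ n]) (auto simp: head_vec_def)
  also have "\<dots> \<le> vec_norm2 (head_vec n y) + \<rho>"
    using head_vec_norm_le[of n "V *\<^sub>v w'"] V Vw' by simp
  finally have "\<tau> * vec_norm2 w \<le> vec_norm2 (head_vec n y) + \<rho>" .
  moreover have "\<tau> * (vec_norm2 y - \<rho>) \<le> \<tau> * vec_norm2 w"
    using ny \<tau>(1) by (rule mult_left_mono)
  \<comment> \<open>\<rho> is paid twice: once for the head of the leakage and once, scaled by
    \<tau>, for replacing the norm of \<open>y\<close> by that of \<open>w\<close>.\<close>
  moreover have "\<tau> * \<rho> \<le> \<rho>" using \<tau> \<rho> by (simp add: mult_left_le_one_le)
  ultimately show ?thesis by (simp add: right_diff_distrib)
qed

section \<open>Norms of the two solutions\<close>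

text \<open>The solution solves its linear system exactly, and the system matrix is the transpose of
  a block of an orthogonal matrix, hence a contraction.\<close>

lemma ttls_solution_lower_bound:
  assumes V: "V \<in> carrier_mat (n + 1) (n + 1)" and VTV: "transpose_mat V * V = 1\<^sub>m (n + 1)"
    and d: "d \<le> n + 1" and \<tau>: "0 < \<tau>"
    and lower: "\<And>w. w \<in> carrier_vec d \<Longrightarrow> \<tau> * vec_norm2 w \<le> vec_norm2 (block11 n d V *\<^sub>v w)"
  shows "ttls_solution n d V \<in> carrier_vec n"
    and "vec_norm2 (block21 n d V) \<le> vec_norm2 (ttls_solution n d V)"
proof -
  let ?B = "transpose_mat (block11 n d V)" and ?\<beta> = "block21 n d V" and ?x = "ttls_solution n d V"
  have B: "?B \<in> carrier_mat d n" using block11_carrier by simp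
  show x: "?x \<in> carrier_vec n"
    unfolding ttls_solution_def using lower by (intro pinv_full_row_rank(1)[OF B block21_carrier \<tau>]) simp
  have Bx: "?B *\<^sub>v ?x = ?\<beta>"
    unfolding ttls_solution_def using lower by (intro pinv_full_row_rank(2)[OF B block21_carrier \<tau>]) simp
  have "(vec_norm2 ?\<beta>)\<^sup>2 = ?\<beta> \<bullet> (?B *\<^sub>v ?x)" by (simp add: Bx vec_norm2_sq_scalar)
  also have "\<dots> = (block11 n d V *\<^sub>v ?\<beta>) \<bullet> ?x"
    using scalar_prod_mult_mat_vec[OF block11_carrier block21_carrier x] by simp
  also have "\<dots> \<le> vec_norm2 (block11 n d V *\<^sub>v ?\<beta>) * vec_norm2 ?x"
    using scalar_prod_le_norms[of "block11 n d V *\<^sub>v ?\<beta>" ?x] x block11_carrier[of n d V] by auto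
  also have "\<dots> \<le> vec_norm2 ?\<beta> * vec_norm2 ?x"
    using block11_isometry_norm_le[OF V VTV d block21_carrier] by (intro mult_right_mono) auto
  finally show "vec_norm2 ?\<beta> \<le> vec_norm2 ?x"
    by (cases "vec_norm2 ?\<beta> = 0") (auto simp: power2_eq_square order_less_le)
qed

text \<open>The right-hand side \<beta> is at most \<open>c\<close> in norm: its squared norm is the
  last entry of \<open>M *\<^sub>v \<beta>\<close>, to which \<open>upper\<close> applies. The
  pseudoinverse then costs a factor \<open>1 / \<mu>\<close>.\<close>

lemma ttls_solution_norm_le:
  assumes M: "M \<in> carrier_mat (n + 1) d" and \<mu>: "0 < \<mu>"
    and lower: "\<And>z. z \<in> carrier_vec d \<Longrightarrow> \<mu> * vec_norm2 z \<le> vec_norm2 (head_vec n (M *\<^sub>v z))"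
    and upper: "\<And>z. z \<in> carrier_vec d \<Longrightarrow> vec_norm2 (M *\<^sub>v z) \<le> c * vec_norm2 z" and c: "0 \<le> c"
  shows "ttls_solution n d M \<in> carrier_vec n"
    and "vec_norm2 (ttls_solution n d M) \<le> c / \<mu>"
proof -
  let ?B = "transpose_mat (block11 n d M)" and ?\<beta> = "block21 n d M" and ?x = "ttls_solution n d M"
  have B: "?B \<in> carrier_mat d n" using block11_carrier by simp
  have low: "\<mu> * vec_norm2 z \<le> vec_norm2 (transpose_mat ?B *\<^sub>v z)" if "z \<in> carrier_vec d" for z
    using lower[OF that] block11_mult_vec_all(1)[OF M that] by simp
  show "?x \<in> carrier_vec n"
    unfolding ttls_solution_def by (rule pinv_full_row_rank(1)[OF B block21_carrier \<mu> low])
  have "(vec_norm2 ?\<beta>)\<^sup>2 = (M *\<^sub>v ?\<beta>) $ n"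
    using block11_mult_vec_all(2)[OF M block21_carrier] by (simp add: vec_norm2_sq_scalar)
  also have "\<dots> \<le> vec_norm2 (M *\<^sub>v ?\<beta>)"
    using index_le_vec_norm2[of n "M *\<^sub>v ?\<beta>"] M by auto
  also have "\<dots> \<le> c * vec_norm2 ?\<beta>" by (rule upper[OF block21_carrier])
  finally have "vec_norm2 ?\<beta> \<le> c"
    using c by (cases "vec_norm2 ?\<beta> = 0") (auto simp: power2_eq_square order_less_le)
  then have "vec_norm2 ?\<beta> / \<mu> \<le> c / \<mu>" using \<mu> by (simp add: divide_right_mono)
  moreover have "vec_norm2 ?x \<le> vec_norm2 ?\<beta> / \<mu>"
    unfolding ttls_solution_def by (rule pinv_full_row_rank(3)[OF B block21_carrier \<mu> low])
  ultimately show "vec_norm2 ?x \<le> c / \<mu>" by linarith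
qed

text \<open>The last column is the image of the last unit vector, whose coordinates are the last row
  of \<open>V\<close>, itself of norm 1. For the second bound the sum over singular values is split
  at \<open>d\<close>, with \<open>s 1\<close> and \<open>s (d + 1)\<close> as bounds of the two
  parts.\<close>

lemma (in svd_decomposition) last_col_norm_bounds:
  assumes n: "n = n' + 1" "n \<le> a" and d: "1 \<le> d" "d \<le> n'" 
  shows "vec_norm2 (col M n') \<le> s 1"
    and "vec_norm2 (col M n') \<le> s 1 * vec_norm2 (block21 n' d V) + s (d + 1)"
proof -
  let ?e = "unit_vec n n'"
  have e: "?e \<in> carrier_vec n" by simp
  have Me: "M *\<^sub>v ?e = col M n'" using M n by (intro eq_vecI) auto
  have ce: "(transpose_mat V *\<^sub>v ?e) $ j = V $$ (n', j)" if "j < n" for j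
    using that V n by simp
  have ne: "vec_norm2 ?e = 1"
    by (rule power2_eq_imp_eq) (use n in \<open>auto simp: vec_norm2_sq_scalar\<close>)
  show "vec_norm2 (col M n') \<le> s 1"
    using norm_M_le[OF e, of 1] n ne Me by simp
  have sum1: "(\<Sum>j<n. (V $$ (n', j))\<^sup>2) = 1"
  proof -
    have "(\<Sum>j<n. ((transpose_mat V *\<^sub>v ?e) $ j)\<^sup>2) = 1"
      using norm_VT[OF e] ne V vec_norm2_sq[of "transpose_mat V *\<^sub>v ?e"]
      by (simp del: index_mult_mat_vec)
    then show ?thesis using ce by (simp del: index_mult_mat_vec)
  qed
  have pos: "0 \<le> s 1" "0 \<le> s (d + 1)" using s_nonneg d n by auto
  have "(vec_norm2 (col M n'))\<^sup>2 = (\<Sum>j<n. (s (j + 1))\<^sup>2 * (V $$ (n', j))\<^sup>2)"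
  proof -
    have "min a n = n" using n by simp
    then show ?thesis using norm_M_sq[OF e] ce Me by (simp del: index_mult_mat_vec)
  qed
  also have "\<dots> = (\<Sum>j<d. (s (j + 1))\<^sup>2 * (V $$ (n', j))\<^sup>2) + (\<Sum>j\<in>{d..<n}. (s (j + 1))\<^sup>2 * (V $$ (n', j))\<^sup>2)"
    unfolding lessThan_atLeast0
    by (rule sum.atLeastLessThan_concat[symmetric]) (use d n in auto)
  also have "\<dots> \<le> (\<Sum>j<d. (s 1)\<^sup>2 * (V $$ (n', j))\<^sup>2) + (\<Sum>j\<in>{d..<n}. (s (d + 1))\<^sup>2 * (V $$ (n', j))\<^sup>2)"
    using d n by (intro add_mono sum_mono mult_right_mono s_sq_antimono) auto
  also have "\<dots> \<le> (\<Sum>j<d. (s 1)\<^sup>2 * (V $$ (n', j))\<^sup>2) + (s (d + 1))\<^sup>2 * (\<Sum>j<n. (V $$ (n', j))\<^sup>2)"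
    unfolding sum_distrib_left by (intro add_left_mono sum_mono2) auto
  also have "\<dots> = (s 1 * vec_norm2 (block21 n' d V))\<^sup>2 + (s (d + 1))\<^sup>2"
    by (simp add: sum1 vec_norm2_sq power_mult_distrib block21_def sum_distrib_left)
  also have "\<dots> \<le> (s 1 * vec_norm2 (block21 n' d V) + s (d + 1))\<^sup>2"
    using pos by (simp add: power2_sum)
  finally show "vec_norm2 (col M n') \<le> s 1 * vec_norm2 (block21 n' d V) + s (d + 1)"
    by (rule power2_le_imp_le) (use pos in auto)
qed

text \<open>The triangle inequality gives at most \<open>1 + 2 * r / (\<tau> - e)\<close>, where
  \<open>r\<close> bounds the reciprocal norm of \<open>x\<close>. As \<open>r\<close> is at least
  1, the numerator \<open>\<tau> - e + 2 * r\<close> is at most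
  \<open>(\<tau> + 1) * (2 * r)\<close>, which the claimed bound dominates.\<close>

lemma ttls_relative_error_bound:
  fixes x x' :: "real vec" and \<tau> e nb \<sigma>\<^sub>1 \<sigma>' \<beta> :: real
  assumes x: "x \<in> carrier_vec n" "x' \<in> carrier_vec n" and x0: "vec_norm2 x \<noteq> 0"
    and x': "vec_norm2 x' \<le> 2 / (\<tau> - e)" and \<tau>: "e < \<tau>" "0 \<le> e"
    and \<beta>: "\<beta> \<le> vec_norm2 x" "nb \<le> \<sigma>\<^sub>1 * \<beta> + \<sigma>'"
    and nb: "nb \<le> \<sigma>\<^sub>1" "\<sigma>' < nb" "0 \<le> \<sigma>'"
  shows "vec_norm2 (x - x') / vec_norm2 x \<le> (sqrt 2 * e + \<tau> + 1) / (\<tau> - e) * (2 * \<sigma>\<^sub>1 / (nb - \<sigma>'))"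
proof -
  define r where "r = \<sigma>\<^sub>1 / (nb - \<sigma>')"
  have gap: "0 < nb - \<sigma>'" using nb by simp
  have r1: "1 \<le> r" using gap nb by (simp add: r_def)
  have xpos: "0 < vec_norm2 x" using x0 by (simp add: order_less_le)
  have "nb - \<sigma>' \<le> \<sigma>\<^sub>1 * vec_norm2 x"
    using \<beta> nb mult_left_mono[OF \<beta>(1), of \<sigma>\<^sub>1] by linarith
  then have inv: "1 / vec_norm2 x \<le> r" using gap xpos by (simp add: r_def field_simps)
  have "vec_norm2 (x - x') / vec_norm2 x \<le> (vec_norm2 x + 2 / (\<tau> - e)) / vec_norm2 x"
    using vec_norm2_diff_le[OF x] x' xpos by (intro divide_right_mono) auto
  also have "\<dots> = 1 + 2 / (\<tau> - e) * (1 / vec_norm2 x)" using xpos by (simp add: add_divide_distrib)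
  also have "\<dots> \<le> 1 + 2 / (\<tau> - e) * r"
    using inv \<tau> by (intro add_left_mono mult_left_mono) auto
  also have "\<dots> = (\<tau> - e + 2 * r) / (\<tau> - e)" using \<tau> by (simp add: field_simps)
  also have "\<dots> \<le> ((sqrt 2 * e + \<tau> + 1) * (2 * r)) / (\<tau> - e)"
  proof (rule divide_right_mono)
    have "\<tau> - e \<le> \<tau> * (2 * r)" using \<tau> r1 mult_left_mono[of 1 "2 * r" \<tau>] by linarith
    moreover have "0 \<le> sqrt 2 * e * (2 * r)" using \<tau> r1 by simp
    ultimately show "\<tau> - e + 2 * r \<le> (sqrt 2 * e + \<tau> + 1) * (2 * r)"
      unfolding distrib_right mult_1_left by linarith
  qed (use \<tau> in simp)
  finally show ?thesis by (simp add: r_def mult.commute)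
qed

section \<open>Numerical constants\<close>

text \<open>\<gamma> is the part of the spectral gap that survives sketching: the gap exceeds
  \<open>40 * real k * \<epsilon> * F\<^sup>2\<close>, and of this one fortieth is reserved for the
  loss \<open>2 * \<kappa>\<close> in the Weyl-type bound. The last claim bounds the total defect of
  the Ritz vectors, isometry defect plus twice the leakage.\<close>

lemma qisvd_constants:
  fixes \<epsilon> \<eta> F :: real and k d :: nat
  assumes \<epsilon>: "0 < \<epsilon>" and k: "0 < k" and d: "d \<le> k" and F: "0 < F"
    and \<eta>: "40 * real k * \<epsilon> * F\<^sup>2 < \<eta>" "\<eta> \<le> F\<^sup>2"
  defines "\<kappa> \<equiv> sqrt 2 * qisvd_theta \<epsilon> k * F\<^sup>2" and "\<gamma> \<equiv> 39 * real k * \<epsilon> * F\<^sup>2"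
  shows "0 < \<gamma>" "0 < \<kappa>" "\<gamma> + 2 * \<kappa> \<le> \<eta>" "\<kappa> \<le> \<gamma>" "\<kappa> / \<gamma> \<le> 1"
    and "\<kappa> / \<gamma> + 2 * (real d * (\<kappa> * (2 + F / sqrt \<gamma>) / \<gamma>)) \<le> sqrt \<epsilon>"
proof -
  define K where "K = real k"
  have K: "1 \<le> K" using k by (simp add: K_def)
  have F2: "0 < F\<^sup>2" using F by simp
  \<comment> \<open>The gap lies above a multiple of \<epsilon> and below \<open>F\<^sup>2\<close>,
    which forces \<epsilon> to be small.\<close>
  have "40 * K * \<epsilon> * F\<^sup>2 < 1 * F\<^sup>2" using \<eta> by (simp add: K_def)
  then have K\<epsilon>: "40 * K * \<epsilon> < 1" using F2 by (simp only: mult_less_cancel_right_pos)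
  have "\<epsilon> \<le> K * \<epsilon>" using K \<epsilon> by simp
  then have \<epsilon>1: "\<epsilon> < 1 / 40" using K\<epsilon> by linarith
  have \<xi>: "0 < qisvd_xi \<epsilon>" "qisvd_xi \<epsilon> \<le> \<epsilon>"
    using \<epsilon> by (auto simp: qisvd_xi_def field_simps)
  have \<theta>: "qisvd_theta \<epsilon> k = (qisvd_xi \<epsilon>)\<^sup>2 / (100 * K ^ 4)"
    by (simp add: qisvd_theta_def qisvd_alpha_def K_def power2_eq_square)
  have \<theta>0: "0 < qisvd_theta \<epsilon> k" unfolding \<theta> using \<xi> K by (intro divide_pos_pos) auto
  show \<gamma>0: "0 < \<gamma>" using \<epsilon> K F2 by (simp add: \<gamma>_def K_def)
  show \<kappa>0: "0 < \<kappa>" using \<theta>0 F2 by (simp add: \<kappa>_def)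
  have K4: "K \<le> K ^ 4" using K by (simp add: self_le_power)
  have "qisvd_theta \<epsilon> k \<le> \<epsilon>\<^sup>2 / (100 * K)"
    unfolding \<theta> using \<xi> K K4 by (intro frac_le power_mono) auto
  also have "\<dots> = \<epsilon> * (\<epsilon> / (100 * K))" by (simp add: power2_eq_square)
  finally have \<theta>le: "qisvd_theta \<epsilon> k \<le> \<epsilon> * (\<epsilon> / (100 * K))" .
  have "sqrt 2 \<le> 2" by (rule real_le_lsqrt) auto
  then have "sqrt 2 * qisvd_theta \<epsilon> k \<le> 2 * (\<epsilon> * (\<epsilon> / (100 * K)))"
    using \<theta>le \<theta>0 by (intro mult_mono) auto
  then have "\<kappa> \<le> 2 * (\<epsilon> * (\<epsilon> / (100 * K))) * F\<^sup>2"
    unfolding \<kappa>_def using F2 by (intro mult_right_mono) auto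
  \<comment> \<open>1950 is 39 * 100 / 2, from the constants in \<gamma>, in \<theta> and in the
    bound 2 for \<open>sqrt 2\<close>.\<close>
  also have "\<dots> = \<gamma> * (\<epsilon> / (1950 * K\<^sup>2))"
    using K by (simp add: \<gamma>_def K_def[symmetric] power2_eq_square)
  finally have \<kappa>le: "\<kappa> \<le> \<gamma> * (\<epsilon> / (1950 * K\<^sup>2))" .
  have ratio: "\<kappa> / \<gamma> \<le> \<epsilon> / (1950 * K\<^sup>2)"
    using \<kappa>le \<gamma>0 by (simp add: pos_divide_le_eq mult.commute)
  have K2: "K \<le> K\<^sup>2" "1 \<le> K\<^sup>2" using K by (auto simp: self_le_power)
  have "\<epsilon> / (1950 * K\<^sup>2) \<le> \<epsilon> / 1950"
    using \<epsilon> K2 by (intro divide_left_mono) auto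
  with ratio have ratio1: "\<kappa> / \<gamma> \<le> \<epsilon> / 1950" by linarith
  then show "\<kappa> / \<gamma> \<le> 1" using \<epsilon>1 by linarith
  then show "\<kappa> \<le> \<gamma>" using \<gamma>0 by simp
  \<comment> \<open>78000 is 1950 * 40, with \<open>\<epsilon> < 1 / 40\<close>.\<close>
  have "\<kappa> \<le> \<gamma> * (1 / 78000)"
  proof -
    have "\<kappa> / \<gamma> \<le> 1 / 78000" using ratio1 \<epsilon>1 by linarith
    then show ?thesis using \<gamma>0 by (simp add: pos_divide_le_eq)
  qed
  moreover have "40 / 39 * \<gamma> < \<eta>" using \<eta> by (simp add: \<gamma>_def mult_ac)
  ultimately show "\<gamma> + 2 * \<kappa> \<le> \<eta>" using \<gamma>0 by linarith
  \<comment> \<open>The number 6 works on both sides: 36 is below the 39 in \<gamma>, so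
    \<open>sqrt \<gamma>\<close> is at least \<open>6 * h * F\<close>, and
    \<open>\<epsilon> < 1 / 40\<close> gives \<open>h \<le> 1 / 6\<close>.\<close>
  define h where "h = sqrt \<epsilon>"
  have h: "0 < h" "h\<^sup>2 = \<epsilon>" using \<epsilon> by (auto simp: h_def)
  have "\<epsilon> \<le> (1 / 6)\<^sup>2" using \<epsilon>1 by (simp add: power2_eq_square)
  then have h1: "h \<le> 1 / 6" unfolding h_def by (intro real_le_lsqrt) auto
  have "(6 * h * F)\<^sup>2 \<le> \<gamma>"
  proof -
    have "36 * \<epsilon> * F\<^sup>2 \<le> 39 * K * \<epsilon> * F\<^sup>2"
      using K \<epsilon> F2 by (intro mult_right_mono) auto
    then show ?thesis by (simp add: power_mult_distrib h \<gamma>_def K_def)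
  qed
  then have "6 * h * F \<le> sqrt \<gamma>" by (rule real_le_rsqrt)
  then have "F / sqrt \<gamma> \<le> F / (6 * h * F)"
    using F h \<gamma>0 by (intro divide_left_mono) auto
  then have Fg: "F / sqrt \<gamma> \<le> 1 / (6 * h)" using F by simp
  have "\<kappa> / \<gamma> * (2 + F / sqrt \<gamma>) \<le> \<epsilon> / (1950 * K\<^sup>2) * (2 + 1 / (6 * h))"
    using ratio Fg \<epsilon> K2 F \<gamma>0 by (intro mult_mono) auto
  also have "\<epsilon> / (1950 * K\<^sup>2) \<le> \<epsilon> / (1950 * K)"
    using \<epsilon> K K2 by (intro divide_left_mono) auto
  finally have leak: "\<kappa> / \<gamma> * (2 + F / sqrt \<gamma>) \<le> \<epsilon> / (1950 * K) * (2 + 1 / (6 * h))"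
    using h by (simp add: mult_right_mono)
  have "real d * (\<kappa> * (2 + F / sqrt \<gamma>) / \<gamma>) = real d * (\<kappa> / \<gamma> * (2 + F / sqrt \<gamma>))"
    by simp
  also have "\<dots> \<le> K * (\<epsilon> / (1950 * K) * (2 + 1 / (6 * h)))"
    by (rule mult_mono[OF _ leak]) (use d \<kappa>0 \<gamma>0 F in \<open>auto simp: K_def\<close>)
  \<comment> \<open>The term \<open>1 / (6 * h)\<close> consumes one of the two factors
    \<open>h\<close> in \<epsilon>, so that the leakage is of order
    \<open>sqrt \<epsilon>\<close>.\<close>
  also have "\<dots> = h / 1950 * (2 * h + 1 / 6)"
    using K h by (simp add: h(2)[symmetric] field_simps power2_eq_square)
  also have "\<dots> \<le> h / 1950 * 1" using h h1 by (intro mult_left_mono) auto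
  finally have "2 * (real d * (\<kappa> * (2 + F / sqrt \<gamma>) / \<gamma>)) \<le> h / 975" by linarith
  moreover have "\<kappa> / \<gamma> \<le> h / 1950"
  proof -
    have "\<epsilon> \<le> h" using h h1 mult_left_mono[of h 1 h] by (simp add: power2_eq_square)
    then show ?thesis using ratio1 by simp
  qed
  ultimately show "\<kappa> / \<gamma> + 2 * (real d * (\<kappa> * (2 + F / sqrt \<gamma>) / \<gamma>)) \<le> sqrt \<epsilon>"
    using h(1) unfolding h_def[symmetric] by linarith
qed

text \<open>The deterministic core: whenever both Gram errors are small, the claimed bound holds.
  \<open>Vh\<close> is described by the entries of its first \<open>d\<close> columns, from which
  both blocks are built.\<close>

lemma qittls_error_of_small_sketch_errors:
  fixes C U V W Ub Vb S Vh :: "real mat" and \<sigma> s \<tau> :: "nat \<Rightarrow> real"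
    and \<epsilon> \<eta> \<epsilon>\<^sub>v :: real and m n p k d :: nat
  assumes C: "C \<in> carrier_mat m (n + 1)" and S: "S \<in> carrier_mat p (n + 1)"
    and W: "W \<in> carrier_mat p p"
    and \<epsilon>: "0 < \<epsilon>" and dims: "n + 1 \<le> m" "1 \<le> d" "d \<le> k" "k \<le> n" "d \<le> p"
    and svd_C: "is_svd C (U, \<sigma>, V)" and svd_W: "is_svd W (Ub, s, Vb)"
    and row_error: "frob_norm (transpose_mat C * C - transpose_mat S * S)
      \<le> sqrt 2 * qisvd_theta \<epsilon> k * (frob_norm C)\<^sup>2"
    and col_error: "frob_norm (S * transpose_mat S - W * transpose_mat W)
      \<le> sqrt 2 * qisvd_theta \<epsilon> k * (frob_norm C)\<^sup>2"
    and frob_S: "frob_norm S \<le> frob_norm C"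
    and \<eta>: "\<eta> \<le> (\<sigma> d)\<^sup>2 - (\<sigma> (d + 1))\<^sup>2" "20 * \<epsilon> * (frob_norm C)\<^sup>2 \<le> \<eta>"
    and sv_V11: "singular_values (block11 n d V) \<tau>"
    and \<epsilon>\<^sub>v: "\<epsilon>\<^sub>v = sqrt (40 * real k * \<epsilon> / \<eta>) * frob_norm C + qisvd_xi \<epsilon>"
    and \<tau>: "\<epsilon>\<^sub>v < \<tau> d"
    and x0: "vec_norm2 (ttls_solution n d V) \<noteq> 0"
    and b: "\<sigma> (d + 1) < vec_norm2 (col C n)"
    and Vh: "\<And>i t. i < n + 1 \<Longrightarrow> t < d \<Longrightarrow>
      Vh $$ (i, t) = (transpose_mat S *\<^sub>v col Ub t) $ i / s (t + 1)"
  shows "vec_norm2 (ttls_solution n d V - ttls_solution n d Vh) / vec_norm2 (ttls_solution n d V)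
    \<le> (sqrt 2 * \<epsilon>\<^sub>v + \<tau> d + 1) / (\<tau> d - \<epsilon>\<^sub>v)
      * (2 * \<sigma> 1 / (vec_norm2 (col C n) - \<sigma> (d + 1)))"
proof -
  define F where "F = frob_norm C"
  define \<kappa> where "\<kappa> = sqrt 2 * qisvd_theta \<epsilon> k * F\<^sup>2"
  define \<gamma> where "\<gamma> = 39 * real k * \<epsilon> * F\<^sup>2"
  have F0: "0 \<le> F" by (simp add: F_def)
  interpret C: svd_decomposition C U V \<sigma> m "n + 1"
    using C svd_C by unfold_locales auto
  have Cn: "vec_norm2 (col C n) \<le> \<sigma> 1"
    and C\<beta>: "vec_norm2 (col C n) \<le> \<sigma> 1 * vec_norm2 (block21 n d V) + \<sigma> (d + 1)"
    using C.last_col_norm_bounds[of n d] dims by auto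
  have \<sigma>d1: "0 \<le> \<sigma> (d + 1)" using C.s_nonneg dims by auto
  have "\<sigma> 1 \<le> F" using C.singular_value_le_frob_norm[of 1] dims by (simp add: F_def)
  then have F: "0 < F" using Cn b \<sigma>d1 by linarith
  have "\<sigma> d \<le> F" using C.singular_value_le_frob_norm[of d] dims by (simp add: F_def)
  then have "(\<sigma> d)\<^sup>2 \<le> F\<^sup>2" using C.s_nonneg[of d] dims by (intro power_mono) auto
  then have \<eta>F: "\<eta> \<le> F\<^sup>2" using \<eta>(1) zero_le_power2[of "\<sigma> (d + 1)"] by linarith
  have "0 < 20 * \<epsilon> * F\<^sup>2" using \<epsilon> F by simp
  then have \<eta>0: "0 < \<eta>" using \<eta>(2) by (simp add: F_def)
  obtain P Q where "is_svd (block11 n d V) (P, \<tau>, Q)"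
    using sv_V11 by (auto simp: singular_values_def)
  then interpret V11: svd_decomposition "block11 n d V" P Q \<tau> n d
    by unfold_locales (simp_all add: block11_carrier)
  have lower: "\<tau> d * vec_norm2 w \<le> vec_norm2 (block11 n d V *\<^sub>v w)" if "w \<in> carrier_vec d" for w
    using dims that by (intro V11.norm_M_ge) auto
  have \<xi>: "0 < qisvd_xi \<epsilon>" using \<epsilon> by (simp add: qisvd_xi_def)
  have \<epsilon>v0: "0 \<le> \<epsilon>\<^sub>v" using \<xi> \<eta>0 \<epsilon> F0 by (simp add: \<epsilon>\<^sub>v F_def)
  then have \<tau>0: "0 < \<tau> d" using \<tau> by linarith
  \<comment> \<open>A block of an orthogonal matrix has no singular value above 1; one unit vector
    suffices as a test.\<close>
  have "\<tau> d * vec_norm2 (unit_vec d 0) \<le> vec_norm2 (unit_vec d 0)"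
    using lower[of "unit_vec d 0"] dims
      block11_isometry_norm_le[OF C.V C.VTV, of d "unit_vec d 0"] by simp
  then have \<tau>1: "\<tau> d \<le> 1" using dims by (simp add: vec_norm2_unit_vec)
  have rootF: "sqrt (40 * real k * \<epsilon> / \<eta>) * F = sqrt (40 * real k * \<epsilon> * F\<^sup>2 / \<eta>)"
    using F0 by (simp add: real_sqrt_mult real_sqrt_divide)
  \<comment> \<open>Here the hypothesis on the smallest singular value of the block becomes a lower
    bound for the spectral gap: the root is below \<open>\<epsilon>\<^sub>v\<close>, hence below
    \<open>\<tau> d\<close> and 1.\<close>
  have "sqrt (40 * real k * \<epsilon> * F\<^sup>2 / \<eta>) < 1"
    using \<tau> \<tau>1 \<xi> unfolding \<epsilon>\<^sub>v F_def[symmetric] rootF by linarith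
  then have \<eta>big: "40 * real k * \<epsilon> * F\<^sup>2 < \<eta>" using \<eta>0 by simp
  \<comment> \<open>Since \<eta> is at most \<open>F\<^sup>2\<close>, the quotient under the root is
    at least \<open>40 * real k * \<epsilon>\<close>.\<close>
  have "sqrt \<epsilon> \<le> sqrt (40 * real k * \<epsilon> * F\<^sup>2 / \<eta>)"
  proof -
    have "1 * \<epsilon> \<le> 40 * real k * \<epsilon>" using \<epsilon> dims by (intro mult_right_mono) auto
    then have "\<epsilon> * \<eta> \<le> 40 * real k * \<epsilon> * F\<^sup>2" using \<eta>F \<eta>0 \<epsilon> by (intro mult_mono) auto
    then show ?thesis using \<eta>0 by (simp add: pos_le_divide_eq)
  qed
  then have root_\<epsilon>: "sqrt \<epsilon> \<le> \<epsilon>\<^sub>v" using \<xi> unfolding \<epsilon>\<^sub>v F_def[symmetric] rootF by linarith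
  have "0 < k" using dims by simp
  note const = qisvd_constants[OF \<epsilon> this \<open>d \<le> k\<close> F \<eta>big \<eta>F, folded \<kappa>_def \<gamma>_def]
  interpret sketch_perturbation C U V \<sigma> m "n + 1" W Ub Vb s p S \<kappa> F
    using W svd_W S dims row_error col_error frob_S
    by unfold_locales (auto simp: \<kappa>_def F_def)
  have "\<kappa> < (\<sigma> d)\<^sup>2"
    using \<eta>(1) const(1-3) zero_le_power2[of "\<sigma> (d + 1)"] by linarith
  then have weyl: "(\<sigma> d)\<^sup>2 - 2 * \<kappa> \<le> (s d)\<^sup>2"
    using dims by (intro sigma_sq_le) auto
  \<comment> \<open>By monotonicity the worst case is \<open>t = d\<close> and \<open>j = d\<close>,
    where the gap \<eta> of \<open>C\<close> has shrunk by \<open>2 * \<kappa>\<close>.\<close>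
  have gap: "\<gamma> \<le> (s t)\<^sup>2 - (\<sigma> (j + 1))\<^sup>2" if "t \<in> {1..d}" "j \<in> {d..<n + 1}" for t j
  proof -
    have "(s d)\<^sup>2 \<le> (s t)\<^sup>2" using that dims by (intro W.s_sq_antimono) auto
    moreover have "(\<sigma> (j + 1))\<^sup>2 \<le> (\<sigma> (d + 1))\<^sup>2" using that dims by (intro C.s_sq_antimono) auto
    ultimately show ?thesis using weyl \<eta>(1) const(3) by linarith
  qed
  have \<gamma>s: "\<gamma> \<le> (s t)\<^sup>2" if "t \<in> {1..d}" for t
  proof -
    have "\<gamma> \<le> (s t)\<^sup>2 - (\<sigma> (d + 1))\<^sup>2" using that dims by (intro gap) auto
    then show ?thesis using zero_le_power2[of "\<sigma> (d + 1)"] by linarith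
  qed
  define R where "R = \<kappa> * (2 + F / sqrt \<gamma>) / \<gamma>"
  have R0: "0 \<le> R" using const(1,2) F0 by (simp add: R_def)
  have norm: "(1 - \<kappa> / \<gamma>) * vec_norm2 z \<le> vec_norm2 (ritz_mat d *\<^sub>v z)"
    "vec_norm2 (ritz_mat d *\<^sub>v z) \<le> 2 * vec_norm2 z" if z: "z \<in> carrier_vec d" for z
  proof -
    let ?Y = "(vec_norm2 (ritz_mat d *\<^sub>v z))\<^sup>2" and ?Z = "(vec_norm2 z)\<^sup>2"
    have *: "\<bar>?Y - ?Z\<bar> \<le> \<kappa> / \<gamma> * ?Z"
      using ritz_mat_norm[OF \<open>d \<le> p\<close> z const(1) \<gamma>s] .
    have q: "0 \<le> \<kappa> / \<gamma>" "\<kappa> / \<gamma> \<le> 1" using const by auto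
    \<comment> \<open>For a ratio in the unit interval, squaring
      \<open>1 - \<kappa> / \<gamma>\<close> only decreases it; this passes from squared norms to
      norms without a root.\<close>
    have "(1 - \<kappa> / \<gamma>)\<^sup>2 \<le> 1 - \<kappa> / \<gamma>"
      using q by (simp add: power2_eq_square mult_left_le_one_le)
    then have "(1 - \<kappa> / \<gamma>)\<^sup>2 * ?Z \<le> (1 - \<kappa> / \<gamma>) * ?Z" by (rule mult_right_mono) simp
    also have "\<dots> \<le> ?Y" using * unfolding left_diff_distrib mult_1_left by linarith
    finally show "(1 - \<kappa> / \<gamma>) * vec_norm2 z \<le> vec_norm2 (ritz_mat d *\<^sub>v z)"
      by - (rule power2_le_imp_le, auto simp: power_mult_distrib)
    have "\<kappa> / \<gamma> * ?Z \<le> 1 * ?Z" using q(2) by (rule mult_right_mono) simp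
    then have "?Y \<le> 4 * ?Z" using * zero_le_power2[of "vec_norm2 z"] by linarith
    then show "vec_norm2 (ritz_mat d *\<^sub>v z) \<le> 2 * vec_norm2 z"
      by - (rule power2_le_imp_le, auto simp: power_mult_distrib)
  qed
  have low: "(\<tau> d - \<epsilon>\<^sub>v) * vec_norm2 z \<le> vec_norm2 (head_vec n (ritz_mat d *\<^sub>v z))"
    if z: "z \<in> carrier_vec d" for z
  proof -
    let ?y = "ritz_mat d *\<^sub>v z"
    have y: "?y \<in> carrier_vec (n + 1)" using ritz_mat_carrier z by (rule mult_mat_vec_carrier)
    have "(\<Sum>j\<in>{d..<n + 1}. ((transpose_mat V *\<^sub>v ?y) $ j)\<^sup>2) \<le> real d * R\<^sup>2 * (vec_norm2 z)\<^sup>2"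
      unfolding R_def using \<open>d \<le> p\<close> z const(1) \<gamma>s const(4) gap by (rule ritz_mat_leakage)
    \<comment> \<open>Enlarging \<open>d\<close> to its square makes the bound a perfect
      square.\<close>
    also have "\<dots> \<le> (real d)\<^sup>2 * R\<^sup>2 * (vec_norm2 z)\<^sup>2"
      using dims by (intro mult_right_mono) (auto simp: power2_eq_square)
    also have "\<dots> = (real d * R * vec_norm2 z)\<^sup>2" by (simp add: power_mult_distrib)
    finally have leak: "(\<Sum>j\<in>{d..<n + 1}. ((transpose_mat V *\<^sub>v ?y) $ j)\<^sup>2) \<le> (real d * R * vec_norm2 z)\<^sup>2" .
    have "\<tau> d * vec_norm2 ?y - 2 * (real d * R * vec_norm2 z) \<le> vec_norm2 (head_vec n ?y)"
      using dims \<tau>0 \<tau>1 R0 by (intro head_vec_lower_bound[OF C.V C.VTV _ _ _ lower y _ leak]) auto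
    moreover have "\<tau> d * ((1 - \<kappa> / \<gamma>) * vec_norm2 z) \<le> \<tau> d * vec_norm2 ?y"
      using norm(1)[OF z] \<tau>0 by (intro mult_left_mono) auto
    \<comment> \<open>As \<open>\<tau> d\<close> is at most 1, isometry defect and doubled leakage
      together cost at most \<open>sqrt \<epsilon>\<close>, which is within
      \<open>\<epsilon>\<^sub>v\<close>.\<close>
    moreover have "(\<tau> d - \<epsilon>\<^sub>v) * vec_norm2 z
        \<le> (\<tau> d * (1 - \<kappa> / \<gamma>) - 2 * (real d * R)) * vec_norm2 z"
    proof (rule mult_right_mono)
      have "\<tau> d * (\<kappa> / \<gamma>) \<le> \<kappa> / \<gamma>" using \<tau>0 \<tau>1 const by (intro mult_left_le_one_le) auto
      then show "\<tau> d - \<epsilon>\<^sub>v \<le> \<tau> d * (1 - \<kappa> / \<gamma>) - 2 * (real d * R)"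
        using const(6) root_\<epsilon> unfolding R_def[symmetric] right_diff_distrib by linarith
    qed simp
    moreover have "(\<tau> d * (1 - \<kappa> / \<gamma>) - 2 * (real d * R)) * vec_norm2 z
        = \<tau> d * ((1 - \<kappa> / \<gamma>) * vec_norm2 z) - 2 * (real d * R * vec_norm2 z)"
      by (simp only: left_diff_distrib mult.assoc)
    ultimately show ?thesis by linarith
  qed
  have entry: "Vh $$ (i, t) = ritz_mat d $$ (i, t)" if "i < n + 1" "t < d" for i t
    unfolding ritz_mat_def ritz_def using that S by (simp add: Vh)
  have "block11 n d Vh = block11 n d (ritz_mat d)" and "block21 n d Vh = block21 n d (ritz_mat d)"
    unfolding block11_def block21_def by (auto simp: entry intro!: eq_matI eq_vecI)
  then have eq: "ttls_solution n d Vh = ttls_solution n d (ritz_mat d)"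
    by (simp add: ttls_solution_def)
  have pos: "0 < \<tau> d - \<epsilon>\<^sub>v" using \<tau> by simp
  have Vh_sol: "ttls_solution n d Vh \<in> carrier_vec n"
    unfolding eq by (rule ttls_solution_norm_le(1)[OF ritz_mat_carrier pos low norm(2)]) auto
  have Vh_norm: "vec_norm2 (ttls_solution n d Vh) \<le> 2 / (\<tau> d - \<epsilon>\<^sub>v)"
    unfolding eq by (rule ttls_solution_norm_le(2)[OF ritz_mat_carrier pos low norm(2)]) auto
  have V_sol: "ttls_solution n d V \<in> carrier_vec n"
    "vec_norm2 (block21 n d V) \<le> vec_norm2 (ttls_solution n d V)"
    using dims by (auto intro!: ttls_solution_lower_bound[OF C.V C.VTV _ \<tau>0 lower])
  show ?thesis
    by (rule ttls_relative_error_bound[OF V_sol(1) Vh_sol x0 Vh_norm \<tau> \<epsilon>v0 V_sol(2) C\<beta> Cn b \<sigma>d1])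
qed

section \<open>Sketch errors of QiSVD\<close>

lemma augment_carrier: "A \<in> carrier_mat m n \<Longrightarrow> augment A b \<in> carrier_mat m (n + 1)"
  by (auto simp: augment_def)

lemma col_augment:
  assumes "A \<in> carrier_mat m n" "b \<in> carrier_vec m"
  shows "col (augment A b) n = b"
  using assms by (auto simp: augment_def nth_append intro!: col_mat_of_cols)

text \<open>The column probabilities divide by the norms of the drawn rows, so it matters that zero
  rows never occur.\<close>

lemma set_row_pmf:
  assumes C: "C \<in> carrier_mat m N" and F: "frob_norm C \<noteq> 0"
  shows "set_pmf (row_pmf C) \<subseteq> {i. i < m \<and> vec_norm2 (row C i) \<noteq> 0}"
  using C by (auto simp: set_pmf_eq pmf_row_pmf[OF F] row_prob_def split: if_splits)

lemma entries_row_norm: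
  assumes "C \<in> carrier_mat m N" "i < m"
  shows "(\<Sum>a<N. (C $$ (i, a))\<^sup>2) = (vec_norm2 (row C i))\<^sup>2"
  using assms by (auto simp: vec_norm2_sq intro!: sum.cong)

lemma sketch_S_carrier: "C \<in> carrier_mat m N \<Longrightarrow> sketch_S C p rs \<in> carrier_mat p N"
  by (simp add: sketch_S_def)

lemma sketch_W_carrier: "sketch_W C p rs cs \<in> carrier_mat p p"
  by (simp add: sketch_W_def)

lemma mult_transpose_entry:
  fixes M :: "real mat"
  assumes "M \<in> carrier_mat a n" "i < a" "j < a"
  shows "(M * transpose_mat M) $$ (i, j) = (\<Sum>t<n. M $$ (i, t) * M $$ (j, t))"
  using assms by (simp add: scalar_prod_def atLeast0LessThan)

lemma row_prob_nonneg: "0 \<le> row_prob C i"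
  by (simp add: row_prob_def)

lemma col_prob_nonneg: "0 \<le> col_prob C p rs j"
  by (simp add: col_prob_def entry_prob_def sum_nonneg)

text \<open>The reason why the second stage is again length-squared sampling, now of the columns of
  \<open>S\<close>: the scaling of each row replaces its squared norm by
  \<open>(frob_norm C)\<^sup>2 / real p\<close>.\<close>

lemma sketch_S_col_norm:
  assumes C: "C \<in> carrier_mat m N" and F: "frob_norm C \<noteq> 0"
    and rs: "\<And>t. t < p \<Longrightarrow> rs t < m \<and> vec_norm2 (row C (rs t)) \<noteq> 0" and j: "j < N"
  shows "(\<Sum>r<p. (sketch_S C p rs $$ (r, j))\<^sup>2) = (frob_norm C)\<^sup>2 * col_prob C p rs j"
proof -
  have "(sketch_S C p rs $$ (r, j))\<^sup>2 = (frob_norm C)\<^sup>2 * (entry_prob C (rs r) j / real p)" if "r < p" for r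
    using that C j rs[OF that] F row_prob_nonneg[of C "rs r"]
    by (simp add: sketch_S_def power_divide entry_prob_def row_prob_def field_simps)
  then have "(\<Sum>r<p. (sketch_S C p rs $$ (r, j))\<^sup>2) = (\<Sum>r<p. (frob_norm C)\<^sup>2 * (entry_prob C (rs r) j / real p))"
    by simp
  also have "\<dots> = (frob_norm C)\<^sup>2 * col_prob C p rs j"
    by (simp add: col_prob_def sum_distrib_left[symmetric] sum_divide_distrib[symmetric])
  finally show ?thesis .
qed

text \<open>The Frobenius norm survives exactly for every admissible draw, because the column
  probabilities add up to 1.\<close>

lemma frob_norm_sketch_S:
  assumes C: "C \<in> carrier_mat m N" and F: "frob_norm C \<noteq> 0" and p: "0 < p"
    and rs: "\<And>t. t < p \<Longrightarrow> rs t < m \<and> vec_norm2 (row C (rs t)) \<noteq> 0"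
  shows "(frob_norm (sketch_S C p rs))\<^sup>2 = (\<Sum>j<N. \<Sum>r<p. (sketch_S C p rs $$ (r, j))\<^sup>2)"
    and "(\<Sum>j<N. \<Sum>r<p. (sketch_S C p rs $$ (r, j))\<^sup>2) = (frob_norm C)\<^sup>2"
proof -
  show "(frob_norm (sketch_S C p rs))\<^sup>2 = (\<Sum>j<N. \<Sum>r<p. (sketch_S C p rs $$ (r, j))\<^sup>2)"
    using sketch_S_carrier[OF C, of p rs]
    by (subst sum.swap) (simp add: frob_norm_sq_entries)
  have pmf: "pmf (col_pmf C p rs) j = (if j < N then col_prob C p rs j else 0)" for j
    using pmf_col_pmf[OF p, of rs C] rs C by simp
  have "(\<Sum>j<N. col_prob C p rs j) = measure_pmf.expectation (col_pmf C p rs) (\<lambda>_. 1)"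
    using expectation_finite_nat(1)[OF pmf, of "\<lambda>_. 1"] by simp
  then have "(\<Sum>j<N. col_prob C p rs j) = 1" by simp
  then show "(\<Sum>j<N. \<Sum>r<p. (sketch_S C p rs $$ (r, j))\<^sup>2) = (frob_norm C)\<^sup>2"
    using sketch_S_col_norm[OF C F rs] by (simp add: sum_distrib_left[symmetric])
qed

section \<open>Expected errors of the two stages\<close>

lemma expected_row_error:
  assumes C: "C \<in> carrier_mat m N" and F: "frob_norm C \<noteq> 0" and p: "0 < p"
  shows "measure_pmf.expectation (Pi_pmf {..<p} 0 (\<lambda>_. row_pmf C))
      (\<lambda>rs. (frob_norm (transpose_mat C * C - transpose_mat (sketch_S C p rs) * sketch_S C p rs))\<^sup>2)
    \<le> (frob_norm C) ^ 4 / real p"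
proof -
  have G: "(frob_norm C)\<^sup>2 = (\<Sum>i<m. \<Sum>a<N. (C $$ (i, a))\<^sup>2)"
    using C by (simp add: frob_norm_sq_entries)
  have pmf: "pmf (row_pmf C) i = (if i < m then (\<Sum>a<N. (C $$ (i, a))\<^sup>2) / (frob_norm C)\<^sup>2 else 0)" for i
    using C by (simp add: pmf_row_pmf[OF F] row_prob_def entries_row_norm)
  have "measure_pmf.expectation (Pi_pmf {..<p} 0 (\<lambda>_. row_pmf C))
      (\<lambda>rs. (frob_norm (transpose_mat C * C - transpose_mat (sketch_S C p rs) * sketch_S C p rs))\<^sup>2)
    = measure_pmf.expectation (Pi_pmf {..<p} 0 (\<lambda>_. row_pmf C))
      (\<lambda>x. \<Sum>a<N. \<Sum>b<N. ((\<Sum>i<m. C $$ (i, a) * C $$ (i, b))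
        - (\<Sum>t<p. C $$ (x t, a) * C $$ (x t, b) / (real p * pmf (row_pmf C) (x t))))\<^sup>2)"
  \<comment> \<open>The integrands are compared on the support, where all drawn indices are in range
    and \<open>pmf\<close> agrees with \<open>row_prob\<close>.\<close>
  proof (rule integral_cong_AE)
    show "AE rs in Pi_pmf {..<p} 0 (\<lambda>_. row_pmf C).
      (frob_norm (transpose_mat C * C - transpose_mat (sketch_S C p rs) * sketch_S C p rs))\<^sup>2
      = (\<Sum>a<N. \<Sum>b<N. ((\<Sum>i<m. C $$ (i, a) * C $$ (i, b))
        - (\<Sum>t<p. C $$ (rs t, a) * C $$ (rs t, b) / (real p * pmf (row_pmf C) (rs t))))\<^sup>2)"
    proof (rule AE_pmfI)
      fix rs assume "rs \<in> set_pmf (Pi_pmf {..<p} 0 (\<lambda>_. row_pmf C))"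
      then have rs: "rs t < m" if "t < p" for t
        using that set_row_pmf[OF C F] by (auto simp: set_Pi_pmf PiE_dflt_def)
      let ?S = "sketch_S C p rs"
      have S: "?S \<in> carrier_mat p N" by (rule sketch_S_carrier[OF C])
      have Sab: "?S $$ (t, a) * ?S $$ (t, b) = C $$ (rs t, a) * C $$ (rs t, b) / (real p * pmf (row_pmf C) (rs t))"
        if "t < p" "a < N" "b < N" for t a b
        using that C rs[of t] row_prob_nonneg[of C "rs t"] by (simp add: sketch_S_def pmf_row_pmf[OF F])
      have "(transpose_mat C * C - transpose_mat ?S * ?S) $$ (a, b)
        = (\<Sum>i<m. C $$ (i, a) * C $$ (i, b))
          - (\<Sum>t<p. C $$ (rs t, a) * C $$ (rs t, b) / (real p * pmf (row_pmf C) (rs t)))"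
        if "a < N" "b < N" for a b
        using that C S Sab mult_transpose_entry[of "transpose_mat C" N m a b]
          mult_transpose_entry[of "transpose_mat ?S" N p a b] by simp
      then show "(frob_norm (transpose_mat C * C - transpose_mat ?S * ?S))\<^sup>2
        = (\<Sum>a<N. \<Sum>b<N. ((\<Sum>i<m. C $$ (i, a) * C $$ (i, b))
          - (\<Sum>t<p. C $$ (rs t, a) * C $$ (rs t, b) / (real p * pmf (row_pmf C) (rs t))))\<^sup>2)"
        using S by (simp add: frob_norm_sq_entries)
    qed
  qed auto
  also have "\<dots> \<le> ((frob_norm C)\<^sup>2)\<^sup>2 / real p"
    by (rule length_squared_sampling[OF pmf G p])
  finally show ?thesis by simp
qed

text \<open>Conditional on the drawn rows, this is the sampling lemma for the columns of
  \<open>S\<close>, in other words with \<open>f j r = S $$ (r, j)\<close>.\<close>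

lemma expected_col_error:
  assumes C: "C \<in> carrier_mat m N" and F: "frob_norm C \<noteq> 0" and p: "0 < p"
    and rs: "\<And>t. t < p \<Longrightarrow> rs t < m \<and> vec_norm2 (row C (rs t)) \<noteq> 0"
  defines "S \<equiv> sketch_S C p rs"
  shows "measure_pmf.expectation (Pi_pmf {..<p} 0 (\<lambda>_. col_pmf C p rs))
      (\<lambda>cs. (frob_norm (S * transpose_mat S - sketch_W C p rs cs * transpose_mat (sketch_W C p rs cs)))\<^sup>2)
    \<le> (frob_norm C) ^ 4 / real p"
proof -
  have S: "S \<in> carrier_mat p N" unfolding S_def by (rule sketch_S_carrier[OF C])
  have pmf': "pmf (col_pmf C p rs) j = (if j < N then col_prob C p rs j else 0)" for j
    using pmf_col_pmf[OF p, of rs C] rs C by simp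
  have pmf: "pmf (col_pmf C p rs) j = (if j < N then (\<Sum>r<p. (S $$ (r, j))\<^sup>2) / (frob_norm C)\<^sup>2 else 0)" for j
    using F sketch_S_col_norm[where p = p and rs = rs, OF C F, of j] rs by (simp add: pmf' S_def)
  have G: "(frob_norm C)\<^sup>2 = (\<Sum>j<N. \<Sum>r<p. (S $$ (r, j))\<^sup>2)"
    using frob_norm_sketch_S(2)[OF C F p rs] by (simp add: S_def)
  have "measure_pmf.expectation (Pi_pmf {..<p} 0 (\<lambda>_. col_pmf C p rs))
      (\<lambda>cs. (frob_norm (S * transpose_mat S - sketch_W C p rs cs * transpose_mat (sketch_W C p rs cs)))\<^sup>2)
    = measure_pmf.expectation (Pi_pmf {..<p} 0 (\<lambda>_. col_pmf C p rs))
      (\<lambda>x. \<Sum>a<p. \<Sum>b<p. ((\<Sum>i<N. S $$ (a, i) * S $$ (b, i))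
        - (\<Sum>t<p. S $$ (a, x t) * S $$ (b, x t) / (real p * pmf (col_pmf C p rs) (x t))))\<^sup>2)"
  proof (rule integral_cong_AE)
    show "AE cs in Pi_pmf {..<p} 0 (\<lambda>_. col_pmf C p rs).
      (frob_norm (S * transpose_mat S - sketch_W C p rs cs * transpose_mat (sketch_W C p rs cs)))\<^sup>2
      = (\<Sum>a<p. \<Sum>b<p. ((\<Sum>i<N. S $$ (a, i) * S $$ (b, i))
        - (\<Sum>t<p. S $$ (a, cs t) * S $$ (b, cs t) / (real p * pmf (col_pmf C p rs) (cs t))))\<^sup>2)"
    proof (rule AE_pmfI)
      fix cs assume "cs \<in> set_pmf (Pi_pmf {..<p} 0 (\<lambda>_. col_pmf C p rs))"
      then have cs: "cs t < N" if "t < p" for t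
      proof -
        have "cs t \<in> set_pmf (col_pmf C p rs)"
          using that \<open>cs \<in> _\<close> by (auto simp: set_Pi_pmf PiE_dflt_def)
        then show ?thesis using pmf'[of "cs t"] by (auto simp: set_pmf_iff split: if_splits)
      qed
      let ?W = "sketch_W C p rs cs"
      have W: "?W \<in> carrier_mat p p" by (rule sketch_W_carrier)
      have Wab: "?W $$ (a, t) * ?W $$ (b, t) = S $$ (a, cs t) * S $$ (b, cs t) / (real p * pmf (col_pmf C p rs) (cs t))"
        if "t < p" "a < p" "b < p" for t a b
        using that cs[of t] col_prob_nonneg[of C p rs "cs t"] by (simp add: sketch_W_def pmf' S_def)
      have "(S * transpose_mat S - ?W * transpose_mat ?W) $$ (a, b)
        = (\<Sum>i<N. S $$ (a, i) * S $$ (b, i))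
          - (\<Sum>t<p. S $$ (a, cs t) * S $$ (b, cs t) / (real p * pmf (col_pmf C p rs) (cs t)))"
        if "a < p" "b < p" for a b
        using that S W Wab mult_transpose_entry[of S p N a b]
          mult_transpose_entry[of ?W p p a b] by simp
      then show "(frob_norm (S * transpose_mat S - ?W * transpose_mat ?W))\<^sup>2
        = (\<Sum>a<p. \<Sum>b<p. ((\<Sum>i<N. S $$ (a, i) * S $$ (b, i))
          - (\<Sum>t<p. S $$ (a, cs t) * S $$ (b, cs t) / (real p * pmf (col_pmf C p rs) (cs t))))\<^sup>2)"
        using W by (simp add: frob_norm_sq_entries)
    qed
  qed auto
  also have "\<dots> \<le> ((frob_norm C)\<^sup>2)\<^sup>2 / real p"
    by (rule length_squared_sampling[where f = "\<lambda>j r. S $$ (r, j)", OF pmf G p])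
  finally show ?thesis by simp
qed

section \<open>Output and sample size of QiSVD\<close>

lemma trunc_index_le: "trunc_index p k \<alpha> W s \<le> p"
proof -
  have "Max (insert 0 {t \<in> {1..p}. (s t)\<^sup>2 \<ge> \<alpha> * (frob_norm W)\<^sup>2}) \<le> p"
    by (subst Max_le_iff) auto
  then show ?thesis by (simp add: trunc_index_def min.coboundedI2)
qed

lemma qisvd_output_facts:
  fixes \<alpha> :: real and k :: nat
  assumes C: "C \<in> carrier_mat m N" and svd: "svd (sketch_W C p rs cs) = (Ub, s, Vb)"
    and Ub: "Ub \<in> carrier_mat p p"
  defines "Vh \<equiv> qisvd_output svd C p k \<alpha> rs cs"
  shows "dim_col Vh \<le> p"
    and "i < N \<Longrightarrow> t < dim_col Vh \<Longrightarrow>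
      Vh $$ (i, t) = (transpose_mat (sketch_S C p rs) *\<^sub>v col Ub t) $ i / s (t + 1)"
proof -
  define l where "l = trunc_index p k \<alpha> (sketch_W C p rs cs) s"
  define U\<^sub>l where "U\<^sub>l = Matrix.mat p l (\<lambda>(r, t). Ub $$ (r, t))"
  let ?St = "transpose_mat (sketch_S C p rs)"
  have l: "l \<le> p" unfolding l_def by (rule trunc_index_le)
  have St: "?St \<in> carrier_mat N p" using sketch_S_carrier[OF C] by simp
  have Ul: "U\<^sub>l \<in> carrier_mat p l" by (simp add: U\<^sub>l_def)
  have "Vh = ?St * U\<^sub>l * mat_diag l (\<lambda>t. inverse (s (t + 1)))"
    by (simp add: Vh_def qisvd_output_def svd Let_def l_def U\<^sub>l_def)
  also have "\<dots> = Matrix.mat N l (\<lambda>(i, t). (?St * U\<^sub>l) $$ (i, t) * inverse (s (t + 1)))"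
    using St Ul by (intro mat_diag_mult_right) auto
  finally have Vh: "Vh = Matrix.mat N l (\<lambda>(i, t). (?St * U\<^sub>l) $$ (i, t) * inverse (s (t + 1)))" .
  then show "dim_col Vh \<le> p" using l by simp
  assume i: "i < N" and t: "t < dim_col Vh"
  then have tl: "t < l" by (simp add: Vh)
  have "col U\<^sub>l t = col Ub t" using tl l Ub by (intro eq_vecI) (auto simp: U\<^sub>l_def)
  then show "Vh $$ (i, t) = (?St *\<^sub>v col Ub t) $ i / s (t + 1)"
    using i tl St Ul by (simp add: Vh divide_inverse)
qed

text \<open>The third quantity is the failure probability that Markov's inequality will produce; the
  sample size is chosen to bring it below \<delta>.\<close>

lemma qisvd_p_bound:
  assumes "0 < \<epsilon>" "0 < k" "0 < \<delta>"
  shows "0 < qisvd_theta \<epsilon> k" "0 < qisvd_p \<epsilon> k \<delta>"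
    and "1 / (real (qisvd_p \<epsilon> k \<delta>) * (qisvd_theta \<epsilon> k)\<^sup>2) \<le> \<delta>"
proof -
  let ?\<theta> = "qisvd_theta \<epsilon> k" and ?p = "qisvd_p \<epsilon> k \<delta>"
  show \<theta>: "0 < ?\<theta>"
    using assms by (simp add: qisvd_theta_def qisvd_alpha_def qisvd_xi_def)
  have pos: "0 < 1 / (?\<theta>\<^sup>2 * \<delta>)" using \<theta> assms by simp
  have le: "1 / (?\<theta>\<^sup>2 * \<delta>) \<le> real ?p"
    unfolding qisvd_p_def by (rule real_nat_ceiling_ge)
  with pos have "0 < real ?p" by linarith
  then show p: "0 < ?p" by simp
  have "1 \<le> real ?p * (?\<theta>\<^sup>2 * \<delta>)" using le \<theta> assms by (simp add: pos_divide_le_eq)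
  then show "1 / (real ?p * ?\<theta>\<^sup>2) \<le> \<delta>" using p \<theta> by (simp add: pos_divide_le_eq mult_ac)
qed

section \<open>Combination of the probabilistic and the deterministic part\<close>

theorem theorem2:
  fixes A C U V :: "real mat" and b x_TTLS :: "real vec"
    and svd :: "real mat \<Rightarrow> real mat \<times> (nat \<Rightarrow> real) \<times> real mat"
    and \<epsilon> \<delta> \<eta>\<^sub>m\<^sub>i\<^sub>n \<epsilon>\<^sub>v :: real and \<sigma> \<sigma>A \<tau> \<eta> :: "nat \<Rightarrow> real" and m n k q d :: nat
  assumes A: "A \<in> carrier_mat m n" and b: "b \<in> carrier_vec m"
    and C: "C = augment A b"
    and params: "\<epsilon> > 0" "0 < \<delta>" "\<delta> < 1" "k > 0"
    and svd: "\<And>M. is_svd M (svd M)"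
    and dims: "m \<ge> n + 1" "1 \<le> d" "d \<le> q" "q \<le> k" "k \<le> n"
    and svd_C: "is_svd C (U, \<sigma>, V)"
    and sv_A: "singular_values A \<sigma>A"
    and gaps: "\<And>i. i \<in> {1..q} \<Longrightarrow> (\<sigma> i)\<^sup>2 - (\<sigma> (i + 1))\<^sup>2 = \<eta> i"
    and \<eta>_min: "\<eta>\<^sub>m\<^sub>i\<^sub>n = Min (\<eta> ` {1..q})"
    and sep: "\<sigma>A q > \<sigma> (q + 1)"
    and x_TTLS: "x_TTLS = ttls_solution n d V"
    and sv_V11: "singular_values (block11 n d V) \<tau>"
    and \<epsilon>\<^sub>v: "\<epsilon>\<^sub>v = sqrt (40 * real k * \<epsilon> / \<eta>\<^sub>m\<^sub>i\<^sub>n) * frob_norm C + qisvd_xi \<epsilon>"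
    and gap_large: "\<eta>\<^sub>m\<^sub>i\<^sub>n \<ge> 20 * \<epsilon> * (frob_norm C)\<^sup>2"
    and x_nonzero: "vec_norm2 x_TTLS \<noteq> 0"
    and \<tau>_large: "\<tau> d > \<epsilon>\<^sub>v"
    and b_large: "vec_norm2 b > \<sigma> (d + 1)"
  shows "measure_pmf.prob (qisvd svd A b \<epsilon> k \<delta>)
           {V_hat. d \<le> dim_col V_hat \<and> dim_col V_hat \<le> q \<longrightarrow>
              vec_norm2 (x_TTLS - ttls_solution n d V_hat) / vec_norm2 x_TTLS
                \<le> (sqrt 2 * \<epsilon>\<^sub>v + \<tau> d + 1) / (\<tau> d - \<epsilon>\<^sub>v)
                    * (2 * \<sigma> 1 / (vec_norm2 b - \<sigma> (d + 1)))}
         \<ge> 1 - \<delta>"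
    (is "measure_pmf.prob _ ?G \<ge> _")
proof -
  define p where "p = qisvd_p \<epsilon> k \<delta>"
  define \<theta> where "\<theta> = qisvd_theta \<epsilon> k"
  define F where "F = frob_norm C"
  note pb = qisvd_p_bound[OF params(1,4,2), folded p_def \<theta>_def]
  have Cc: "C \<in> carrier_mat m (n + 1)" unfolding C by (rule augment_carrier[OF A])
  have colC: "col C n = b" unfolding C by (rule col_augment[OF A b])
  interpret C: svd_decomposition C U V \<sigma> m "n + 1"
    using Cc svd_C by unfold_locales auto
  have "\<sigma> (d + 1) \<ge> 0" using C.s_nonneg dims by auto
  moreover have "vec_norm2 b \<le> F"
    using C.last_col_norm_bounds(1)[of n d] C.singular_value_le_frob_norm[of 1] dims colC by (simp add: F_def)
  ultimately have F: "0 < F" using b_large by linarith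
  then have F0: "frob_norm C \<noteq> 0" by (simp add: F_def)
  have \<eta>d: "\<eta>\<^sub>m\<^sub>i\<^sub>n \<le> (\<sigma> d)\<^sup>2 - (\<sigma> (d + 1))\<^sup>2"
    using gaps[of d] dims by (simp add: \<eta>_min)
  let ?P = "Pi_pmf {..<p} 0 (\<lambda>_. row_pmf C)"
  let ?Q = "\<lambda>rs. Pi_pmf {..<p} 0 (\<lambda>_. col_pmf C p rs)"
  let ?S = "sketch_S C p" and ?W = "sketch_W C p"
  let ?X = "\<lambda>rs. (frob_norm (transpose_mat C * C - transpose_mat (?S rs) * ?S rs))\<^sup>2"
  let ?Y = "\<lambda>rs cs. (frob_norm (?S rs * transpose_mat (?S rs) - ?W rs cs * transpose_mat (?W rs cs)))\<^sup>2"
  let ?out = "qisvd_output svd C p k (qisvd_alpha \<epsilon> k)"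
  have rs: "rs t < m \<and> vec_norm2 (row C (rs t)) \<noteq> 0" if "rs \<in> set_pmf ?P" "t < p" for rs t
    using that set_row_pmf[OF Cc F0] by (auto simp: set_Pi_pmf PiE_dflt_def)
  have finP: "finite (set_pmf ?P)"
  proof -
    have "finite (set_pmf (row_pmf C))"
      by (rule finite_subset[OF set_row_pmf[OF Cc F0]]) simp
    then show ?thesis by (simp add: set_Pi_pmf finite_PiE_dflt)
  qed
  have finQ: "finite (set_pmf (?Q rs))" if "rs \<in> set_pmf ?P" for rs
  proof -
    have "set_pmf (col_pmf C p rs) \<subseteq> {..<n + 1}"
      using pmf_col_pmf[OF pb(2), of rs C] rs[OF that] Cc by (auto simp: set_pmf_eq split: if_splits)
    then have "finite (set_pmf (col_pmf C p rs))" by (rule finite_subset) simp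
    then show ?thesis by (simp add: set_Pi_pmf finite_PiE_dflt)
  qed
  have good: "?out rs cs \<in> ?G"
    if r: "rs \<in> set_pmf ?P" and "cs \<in> set_pmf (?Q rs)" and sum: "?X rs + ?Y rs cs \<le> 2 * \<theta>\<^sup>2 * F ^ 4" for rs cs
  proof -
    obtain Ub s Vb where W: "svd (?W rs cs) = (Ub, s, Vb)" by (cases "svd (?W rs cs)") auto
    have svdW: "is_svd (?W rs cs) (Ub, s, Vb)" using svd[of "?W rs cs"] W by simp
    have Wc: "?W rs cs \<in> carrier_mat p p" by (rule sketch_W_carrier)
    then have Ub: "Ub \<in> carrier_mat p p" using svdW by simp
    \<comment> \<open>The threshold for the sum is the square of the admissible Gram error. Both
      summands are nonnegative, so each stays below it.\<close>
    have sq: "2 * \<theta>\<^sup>2 * F ^ 4 = (sqrt 2 * \<theta> * F\<^sup>2)\<^sup>2"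
      by (simp add: power_mult_distrib)
    have nonneg: "0 \<le> sqrt 2 * \<theta> * F\<^sup>2" using pb(1) by simp
    have "?X rs \<le> (sqrt 2 * \<theta> * F\<^sup>2)\<^sup>2" "?Y rs cs \<le> (sqrt 2 * \<theta> * F\<^sup>2)\<^sup>2"
      using sum sq zero_le_power2 add_increasing2 by (smt (verit))+
    note row = power2_le_imp_le[OF this(1) nonneg] and col = power2_le_imp_le[OF this(2) nonneg]
    have "(frob_norm (?S rs))\<^sup>2 = (frob_norm C)\<^sup>2"
      using frob_norm_sketch_S[OF Cc F0 pb(2) rs[OF r]] by simp
    then have S: "frob_norm (?S rs) \<le> frob_norm C" by - (rule power2_le_imp_le, auto)
    note out = qisvd_output_facts[where svd = svd and k = k and \<alpha> = "qisvd_alpha \<epsilon> k", OF Cc W Ub]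
    show ?thesis
    proof (intro CollectI impI, elim conjE)
      \<comment> \<open>As the output has at most \<open>p\<close> columns, this also yields
        \<open>d \<le> p\<close>.\<close>
      assume d: "d \<le> dim_col (?out rs cs)"
      show "vec_norm2 (x_TTLS - ttls_solution n d (?out rs cs)) / vec_norm2 x_TTLS
          \<le> (sqrt 2 * \<epsilon>\<^sub>v + \<tau> d + 1) / (\<tau> d - \<epsilon>\<^sub>v) * (2 * \<sigma> 1 / (vec_norm2 b - \<sigma> (d + 1)))"
        unfolding x_TTLS colC[symmetric]
        by (rule qittls_error_of_small_sketch_errors[OF Cc sketch_S_carrier[OF Cc] Wc params(1) dims(1,2) _ dims(5)
              _ svd_C svdW row[unfolded \<theta>_def F_def] col[unfolded \<theta>_def F_def] S \<eta>d gap_large sv_V11 \<epsilon>\<^sub>v \<tau>_large])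
          (use dims d out x_nonzero b_large in \<open>auto simp: x_TTLS colC\<close>)
    qed
  qed
  \<comment> \<open>The 2 in the threshold, which is the source of \<open>sqrt 2\<close> in the
    admissible error, cancels the 2 that comes from the two stages.\<close>
  have "1 - 2 * (F ^ 4 / real p) / (2 * \<theta>\<^sup>2 * F ^ 4)
      \<le> measure_pmf.prob (bind_pmf ?P (\<lambda>rs. bind_pmf (?Q rs) (\<lambda>cs. return_pmf (?out rs cs)))) ?G"
  proof (rule two_stage_markov[OF finP finQ, where X = ?X and Y = ?Y])
    show "measure_pmf.expectation ?P ?X \<le> F ^ 4 / real p"
      unfolding F_def by (rule expected_row_error[OF Cc F0 pb(2)])
    show "measure_pmf.expectation (?Q rs) (?Y rs) \<le> F ^ 4 / real p" if "rs \<in> set_pmf ?P" for rs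
      unfolding F_def by (rule expected_col_error[OF Cc F0 pb(2) rs[OF that]])
    show "0 < 2 * \<theta>\<^sup>2 * F ^ 4" using pb(1) F by simp
  qed (use good in auto)
  moreover have "2 * (F ^ 4 / real p) / (2 * \<theta>\<^sup>2 * F ^ 4) = 1 / (real p * \<theta>\<^sup>2)"
    using F by (simp add: field_simps)
  moreover have "qisvd svd A b \<epsilon> k \<delta>
      = bind_pmf ?P (\<lambda>rs. bind_pmf (?Q rs) (\<lambda>cs. return_pmf (?out rs cs)))"
    by (simp add: qisvd_def Let_def C p_def)
  ultimately show ?thesis using pb(3) by simp
qed

end
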